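(* Let $(\Lambda_Q,f)$ be a $C^{1+\mathrm{Lip}}$ expansive and transitive Markov system (as defined in the context). Then a point $x\in\Lambda_Q$ belongs to $\Lambda_Q\setminus H$ if and only if it is either a parabolic periodic point or a parabolic preperiodic point.
   Context: **Markov systems.** Let $I\subset\mathbb R$ be a compact interval and $I_1,\dots,I_p$ ($p\ge1$) pairwise disjoint non-degenerate closed subintervals of $I$. For each $i\in\{1,\dots,p\}$ let $g_i\colon\bigcup_{j=1}^pI_j\to\operatorname{int}(I_i)$ be a $C^{1+\mathrm{Lip}}$ diffeomorphism onto its range $R(g_i)$ (injective, $C^1$ with nowhere vanishing derivative, derivative Lipschitz). Write $g_{i_1\ldots i_n}=g_{i_1}\circ\cdots\circ g_{i_n}$, $\Delta_{i_1\ldots i_n}=g_{i_1\ldots i_{n-1}}(I_{i_n})$ for $(i_1\ldots i_n)\in\{1,\dots,p\}^n$ (cylinders), and $f(x)=g_i^{-1}(x)$ for $x\in R(g_i)$. Expansive (standing assumption) means: $d_n:=\max_{(i_1\ldots i_n)}|\Delta_{i_1\ldots i_n}|\to0$ as $n\to\infty$. Then $\pi(i_1i_2\ldots)=\bigcap_n\Delta_{i_1\ldots i_n}$ defines a point for each sequence in $\Sigma=\{1,\dots,p\}^{\mathbb N}$. Let $Q$ be a finite set of finite words over $\{1,\dots,p\}$, $\Sigma_Q\subset\Sigma$ the set of sequences containing no word of $Q$ as a sub-word, and $\Lambda_Q=\pi(\Sigma_Q)$. With $\sigma$ the left shift, $\Sigma_Q$ is assumed non-empty and completely invariant: $\sigma(\Sigma_Q)=\Sigma_Q$.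 Transitive means $f|\Lambda_Q$ is topologically transitive: for all non-empty relatively open $U,V\subset\Lambda_Q$ there is $n\ge1$ with $f^n(U)\cap V\ne\emptyset$. **The set $H$.** $\operatorname{Dist}g|_Z=\sup_{x,y\in Z}|g'(x)|/|g'(y)|$. $H$ is the set of $x\in\Lambda_Q$ for which there exist constants $c_1,c_2>0$, an increasing sequence of natural numbers $(n_k)_k$ and a positive sequence $(r_k)_k$ decreasing to $0$ (all depending on $x$) such that for every $k\ge1$ the map $f^{n_k}$ is defined on $B(x,r_k)=(x-r_k,x+r_k)$ and $\operatorname{diam}f^{n_k}(B(x,r_k))>c_1$, $\operatorname{Dist}f^{n_k}|_{B(x,r_k)}<c_2$. **Parabolic points.** A periodic point $x=f^k(x)\in\Lambda_Q$, $k\ge1$, is parabolic if $|(f^k)'(x)|=1$. A point $y\in\Lambda_Q$ is parabolic preperiodic if $f^m(y)$ is a parabolic periodic point for some $m\ge1$. *)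

theory Defs
  imports "HOL-Analysis.Analysis"
begin

definition base :: "nat \<Rightarrow> (nat \<Rightarrow> real set) \<Rightarrow> real set" where
  "base p J = (\<Union>j\<in>{1..p}. J j)"

(* Derivatives are taken within S, so they are one-sided at endpoints; continuity of the
   derivative is part of the Lipschitz condition. *)
definition C1Lip_diffeo_on :: "real set \<Rightarrow> (real \<Rightarrow> real) \<Rightarrow> bool" where
  "C1Lip_diffeo_on S h \<longleftrightarrow> inj_on h S \<and>
     (\<exists>h'. (\<forall>x\<in>S. (h has_real_derivative h' x) (at x within S) \<and> h' x \<noteq> 0) \<and>
           (\<exists>L. L-lipschitz_on S h'))"

definition markov_system ::
  "real set \<Rightarrow> nat \<Rightarrow> (nat \<Rightarrow> real set) \<Rightarrow> (nat \<Rightarrow> real \<Rightarrow> real) \<Rightarrow> bool" where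
  "markov_system I p J g \<longleftrightarrow>
     (\<exists>a b. a \<le> b \<and> I = {a..b}) \<and> p \<ge> 1 \<and>
     (\<forall>i\<in>{1..p}. J i \<subseteq> I \<and> (\<exists>a b. a < b \<and> J i = {a..b})) \<and>
     disjoint_family_on J {1..p} \<and>
     (\<forall>i\<in>{1..p}. g i ` base p J \<subseteq> interior (J i) \<and> C1Lip_diffeo_on (base p J) (g i))"

definition words :: "nat \<Rightarrow> nat \<Rightarrow> nat list set" where
  "words p n = {w. set w \<subseteq> {1..p} \<and> length w = n}"

(* Only meaningful for nonempty words. *)
definition cylinder :: "(nat \<Rightarrow> real set) \<Rightarrow> (nat \<Rightarrow> real \<Rightarrow> real) \<Rightarrow> nat list \<Rightarrow> real set" where
  "cylinder J g w = foldr (\<circ>) (map g (butlast w)) id ` J (last w)"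

definition expansive :: "nat \<Rightarrow> (nat \<Rightarrow> real set) \<Rightarrow> (nat \<Rightarrow> real \<Rightarrow> real) \<Rightarrow> bool" where
  "expansive p J g \<longleftrightarrow>
     (\<lambda>n. Max ((\<lambda>w. diameter (cylinder J g w)) ` words p n)) \<longlonglongrightarrow> 0"

(* Sequences are indexed from 0. The intersection is a singleton for sequences over {1..p}
   in an expansive Markov system. *)
definition coding :: "(nat \<Rightarrow> real set) \<Rightarrow> (nat \<Rightarrow> real \<Rightarrow> real) \<Rightarrow> (nat \<Rightarrow> nat) \<Rightarrow> real" where
  "coding J g s = the_elem (\<Inter>n\<in>{1..}. cylinder J g (map s [0..<n]))"

definition Sigma_Q :: "nat \<Rightarrow> nat list set \<Rightarrow> (nat \<Rightarrow> nat) set" where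
  "Sigma_Q p Q = {s. range s \<subseteq> {1..p} \<and> (\<forall>w\<in>Q. \<forall>k. map s [k..<k + length w] \<noteq> w)}"

definition shift :: "(nat \<Rightarrow> nat) \<Rightarrow> nat \<Rightarrow> nat" where
  "shift s = (\<lambda>n. s (Suc n))"

definition Lambda_Q ::
  "nat \<Rightarrow> (nat \<Rightarrow> real set) \<Rightarrow> (nat \<Rightarrow> real \<Rightarrow> real) \<Rightarrow> nat list set \<Rightarrow> real set" where
  "Lambda_Q p J g Q = coding J g ` Sigma_Q p Q"

(* The partial map f with domain the union of the ranges R(g_i) is represented by the total
   function markov_map, whose values off markov_dom are irrelevant. *)
definition markov_dom :: "nat \<Rightarrow> (nat \<Rightarrow> real set) \<Rightarrow> (nat \<Rightarrow> real \<Rightarrow> real) \<Rightarrow> real set" where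
  "markov_dom p J g = (\<Union>i\<in>{1..p}. g i ` base p J)"

definition markov_map :: "nat \<Rightarrow> (nat \<Rightarrow> real set) \<Rightarrow> (nat \<Rightarrow> real \<Rightarrow> real) \<Rightarrow> real \<Rightarrow> real" where
  "markov_map p J g x =
     inv_into (base p J) (g (THE i. i \<in> {1..p} \<and> x \<in> g i ` base p J)) x"

definition iterate_defined_on ::
  "nat \<Rightarrow> (nat \<Rightarrow> real set) \<Rightarrow> (nat \<Rightarrow> real \<Rightarrow> real) \<Rightarrow> nat \<Rightarrow> real set \<Rightarrow> bool" where
  "iterate_defined_on p J g n Z \<longleftrightarrow>
     (\<forall>z\<in>Z. \<forall>j<n. (markov_map p J g ^^ j) z \<in> markov_dom p J g)"

definition transitive_system ::
  "nat \<Rightarrow> (nat \<Rightarrow> real set) \<Rightarrow> (nat \<Rightarrow> real \<Rightarrow> real) \<Rightarrow> nat list set \<Rightarrow> bool" where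
  "transitive_system p J g Q \<longleftrightarrow>
     (\<forall>U V. openin (top_of_set (Lambda_Q p J g Q)) U \<and> U \<noteq> {} \<and>
            openin (top_of_set (Lambda_Q p J g Q)) V \<and> V \<noteq> {} \<longrightarrow>
            (\<exists>n\<ge>1. (markov_map p J g ^^ n) ` U \<inter> V \<noteq> {}))"

(* Valued in ereal so that an infinite supremum is not confused with a finite one. Used only
   on open Z, where the ordinary derivative is the right one. *)
definition Dist :: "(real \<Rightarrow> real) \<Rightarrow> real set \<Rightarrow> ereal" where
  "Dist h Z = (SUP (y, z)\<in>Z \<times> Z. ereal (\<bar>deriv h y\<bar> / \<bar>deriv h z\<bar>))"

definition H_set ::
  "nat \<Rightarrow> (nat \<Rightarrow> real set) \<Rightarrow> (nat \<Rightarrow> real \<Rightarrow> real) \<Rightarrow> nat list set \<Rightarrow> real set" where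
  "H_set p J g Q = {x \<in> Lambda_Q p J g Q.
     \<exists>c1>0. \<exists>c2>0. \<exists>(n :: nat \<Rightarrow> nat) (r :: nat \<Rightarrow> real).
       strict_mono n \<and> (\<forall>k. r k > 0) \<and> decseq r \<and> r \<longlonglongrightarrow> 0 \<and>
       (\<forall>k. iterate_defined_on p J g (n k) (ball x (r k)) \<and>
            diameter ((markov_map p J g ^^ n k) ` ball x (r k)) > c1 \<and>
            Dist (markov_map p J g ^^ n k) (ball x (r k)) < ereal c2)}"

(* Every point of Lambda_Q is interior to the domain of every iterate, so the two-sided
   derivative is the right one here as well. *)
definition parabolic_periodic ::
  "nat \<Rightarrow> (nat \<Rightarrow> real set) \<Rightarrow> (nat \<Rightarrow> real \<Rightarrow> real) \<Rightarrow> nat list set \<Rightarrow> real \<Rightarrow> bool" where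
  "parabolic_periodic p J g Q x \<longleftrightarrow> x \<in> Lambda_Q p J g Q \<and>
     (\<exists>k\<ge>1. (markov_map p J g ^^ k) x = x \<and> \<bar>deriv (markov_map p J g ^^ k) x\<bar> = 1)"

definition parabolic_preperiodic ::
  "nat \<Rightarrow> (nat \<Rightarrow> real set) \<Rightarrow> (nat \<Rightarrow> real \<Rightarrow> real) \<Rightarrow> nat list set \<Rightarrow> real \<Rightarrow> bool" where
  "parabolic_preperiodic p J g Q y \<longleftrightarrow> y \<in> Lambda_Q p J g Q \<and>
     (\<exists>m\<ge>1. parabolic_periodic p J g Q ((markov_map p J g ^^ m) y))"

end

theory Submission
  imports Defs
begin

text \<open>
  Let \<open>y n\<close> be the orbit of \<open>x\<close>. If \<open>x\<close> lies in \<open>H\<close>, then \<open>\<bar>(f\<^sup>n)'(x)\<bar>\<close> is unbounded, which fails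
  when the orbit ends in a parabolic cycle. For the converse, the distortion of \<open>f\<^sup>n\<close> on an
  interval is controlled by the total length of its first \<open>n\<close> images. So it suffices to find
  infinitely many \<open>n\<close> such that the pullbacks along the orbit of an interval around \<open>y n\<close> have
  bounded total length. Pullbacks that are pairwise disjoint have total length at most \<open>\<bar>I\<bar>\<close>,
  and returns to the interval after a long time contract, so it is enough to have disjointness
  between consecutive returns and long return times.

  Let \<open>\<zeta>\<close> be the coding of \<open>limsup y\<close>. If \<open>\<zeta>\<close> is not periodic, use a long prefix \<open>w\<close> of \<open>\<zeta>\<close>: its
  return times are long, and its cylinder, enlarged by the whole gap to its right that the orbit
  eventually avoids, has disjoint pullbacks. If \<open>\<zeta>\<close> is \<open>q\<close>-periodic but the coding of \<open>x\<close> is not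
  eventually so, some word of length \<open>q + 1\<close> violating the periodicity recurs with unbounded gaps,
  since the orbit follows \<open>\<zeta>\<close> for arbitrarily long times. If the coding of \<open>x\<close> is
  eventually periodic, the multiplier of the cycle is at least 1 by expansivity, and if it exceeds 1
  the pullback lengths form a geometric series.
\<close>

section \<open>Segments on the real line\<close>

lemma injective_image_closed_segment:
  fixes h :: "real \<Rightarrow> real"
  assumes "continuous_on {a..b} h" "inj_on h {a..b}" "a \<le> b"
    and "t1 \<in> {a..b}" "t2 \<in> {a..b}"
  shows "h ` closed_segment t1 t2 = closed_segment (h t1) (h t2)"
proof -
  have "closed_segment t1 t2 \<subseteq> {a..b}"
    using assms(4,5) by (metis closed_segment_subset convex_real_interval(5))
  then show ?thesis
    using assms by (meson continuous_injective_image_segment_1 continuous_on_subset inj_on_subset)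
qed

text \<open>Additivity of Lebesgue measure. The endpoints are unordered because inverse branches may
  reverse orientation.\<close>

lemma disjoint_segments_length:
  fixes u v :: "'a \<Rightarrow> real"
  assumes fin: "finite F" and ab: "a \<le> b"
    and sub: "\<And>k. k \<in> F \<Longrightarrow> u k \<in> {a..b} \<and> v k \<in> {a..b}"
    and disj: "\<And>i j. i \<in> F \<Longrightarrow> j \<in> F \<Longrightarrow> i \<noteq> j \<Longrightarrow>
      closed_segment (u i) (v i) \<inter> closed_segment (u j) (v j) = {}"
  shows "(\<Sum>k\<in>F. \<bar>u k - v k\<bar>) \<le> b - a"
proof -
  let ?S = "\<lambda>k. closed_segment (u k) (v k)"
  have m: "measure lborel (?S k) = \<bar>u k - v k\<bar>" for k
    by (auto simp: closed_segment_eq_real_ivl)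
  have fm: "emeasure lborel (?S k) \<noteq> \<infinity>" for k
    by (auto simp: closed_segment_eq_real_ivl)
  have "(\<Sum>k\<in>F. \<bar>u k - v k\<bar>) = measure lborel (\<Union>k\<in>F. ?S k)"
    unfolding m[symmetric]
    by (rule measure_finite_Union[symmetric])
      (use fin disj fm in \<open>auto simp: disjoint_family_on_def\<close>)
  also have "\<dots> \<le> measure lborel {a..b}"
  proof (rule measure_mono_fmeasurable)
    show "(\<Union>k\<in>F. ?S k) \<subseteq> {a..b}"
      using sub by (meson UN_least closed_segment_subset convex_real_interval(5))
    show "(\<Union>k\<in>F. ?S k) \<in> sets lborel"
      using fin by (intro sets.finite_UN) auto
    show "{a..b} \<in> fmeasurable lborel"
      using ab by (simp add: fmeasurable_def)
  qed
  also have "\<dots> = b - a" using ab by simp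
  finally show ?thesis .
qed

section \<open>Markov systems: intervals, inverse branches and their derivatives\<close>

locale markov =
  fixes I :: "real set" and p :: nat and J :: "nat \<Rightarrow> real set" and g :: "nat \<Rightarrow> real \<Rightarrow> real"
  assumes system: "markov_system I p J g" and expands: "expansive p J g"
begin

abbreviation "B \<equiv> base p J"
abbreviation "f \<equiv> markov_map p J g"
definition "lo i = Inf (J i)"
definition "hi i = Sup (J i)"
definition "len = measure lborel I"

text \<open>A derivative within \<open>base p J\<close>, chosen nonvanishing and Lipschitz there.
  \<open>deriv\<close> would not do: at the endpoints of the intervals only one-sided derivatives
  are given.\<close>

definition "gd i = (SOME h'. (\<forall>x\<in>B. (g i has_real_derivative h' x) (at x within B) \<and> h' x \<noteq> 0) \<and>
  (\<exists>L. L-lipschitz_on B h'))"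

definition G :: "nat list \<Rightarrow> real \<Rightarrow> real" where
  "G w = foldr (\<circ>) (map g w) id"

text \<open>The chain rule product: \<open>Gd w\<close> is the derivative of \<open>G w\<close> (see
  \<open>G_deriv\<close>).\<close>

primrec Gd :: "nat list \<Rightarrow> real \<Rightarrow> real" where
  "Gd [] t = 1"
| "Gd (i # w) t = gd i (G w t) * Gd w t"

abbreviation "cyl \<equiv> cylinder J g"

lemma J_eq: "i \<in> {1..p} \<Longrightarrow> J i = {lo i..hi i}"
  and lo_less_hi: "i \<in> {1..p} \<Longrightarrow> lo i < hi i"
proof -
  assume "i \<in> {1..p}"
  then obtain a b where "a < b" "J i = {a..b}"
    using system unfolding markov_system_def by blast
  then show "J i = {lo i..hi i}" "lo i < hi i" by (auto simp: lo_def hi_def)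
qed

lemma I_interval: obtains a where "I = {a..a + len}" "len \<ge> 0"
proof -
  obtain a b where "a \<le> b" "I = {a..b}"
    using system unfolding markov_system_def by blast
  then show ?thesis using that[of a] unfolding len_def by fastforce
qed

lemma J_subset_I: "i \<in> {1..p} \<Longrightarrow> J i \<subseteq> I"
  using system unfolding markov_system_def by blast

lemma J_subset_B: "i \<in> {1..p} \<Longrightarrow> J i \<subseteq> B"
  by (auto simp: base_def)

lemma B_cases: assumes "t \<in> B" obtains i where "i \<in> {1..p}" "t \<in> J i"
  using assms by (auto simp: base_def)

lemma B_subset_I: "B \<subseteq> I"
  unfolding base_def using J_subset_I by (intro UN_least)

lemma abs_diff_le_len: "t1 \<in> B \<Longrightarrow> t2 \<in> B \<Longrightarrow> \<bar>t1 - t2\<bar> \<le> len"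
proof -
  assume t: "t1 \<in> B" "t2 \<in> B"
  obtain a where "I = {a..a + len}" by (rule I_interval)
  then have "t1 \<in> {a..a + len}" "t2 \<in> {a..a + len}" using t B_subset_I by blast+
  then show ?thesis by auto
qed

lemma J_disjoint: "i \<in> {1..p} \<Longrightarrow> j \<in> {1..p} \<Longrightarrow> t \<in> J i \<Longrightarrow> t \<in> J j \<Longrightarrow> i = j"
  using system unfolding markov_system_def disjoint_family_on_def by blast

lemma compact_B: "compact B"
  unfolding base_def using J_eq by (intro compact_UN) auto

lemma g_interior: "i \<in> {1..p} \<Longrightarrow> t \<in> B \<Longrightarrow> g i t \<in> interior (J i)"
  using system unfolding markov_system_def by blast

lemma g_J: "i \<in> {1..p} \<Longrightarrow> t \<in> B \<Longrightarrow> g i t \<in> J i"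
  using g_interior interior_subset by blast

lemma g_inj: "i \<in> {1..p} \<Longrightarrow> inj_on (g i) B"
  using system unfolding markov_system_def C1Lip_diffeo_on_def by blast

lemma gd_props:
  assumes "i \<in> {1..p}"
  shows "\<And>t. t \<in> B \<Longrightarrow> (g i has_real_derivative gd i t) (at t within B)"
    and "\<And>t. t \<in> B \<Longrightarrow> gd i t \<noteq> 0"
    and "\<exists>L. L-lipschitz_on B (gd i)"
proof -
  have "\<exists>h'. (\<forall>x\<in>B. (g i has_real_derivative h' x) (at x within B) \<and> h' x \<noteq> 0) \<and>
      (\<exists>L. L-lipschitz_on B h')"
    using system assms unfolding markov_system_def C1Lip_diffeo_on_def by blast
  from someI_ex[OF this] show
    "\<And>t. t \<in> B \<Longrightarrow> (g i has_real_derivative gd i t) (at t within B)"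
    "\<And>t. t \<in> B \<Longrightarrow> gd i t \<noteq> 0"
    "\<exists>L. L-lipschitz_on B (gd i)"
    unfolding gd_def[symmetric] by blast+
qed

lemma gd_cont: "i \<in> {1..p} \<Longrightarrow> continuous_on B (gd i)"
  using gd_props(3) lipschitz_on_continuous_on by blast

lemma g_cont: "i \<in> {1..p} \<Longrightarrow> continuous_on B (g i)"
  using gd_props(1) by (meson DERIV_continuous_on)

lemma G_Nil [simp]: "G [] t = t"
  and G_Cons [simp]: "G (i # w) t = g i (G w t)"
  by (simp_all add: G_def)

lemma G_append: "G (u @ v) t = G u (G v t)"
  by (induction u) auto

lemma G_in_B: "set u \<subseteq> {1..p} \<Longrightarrow> t \<in> B \<Longrightarrow> G u t \<in> B"
  by (induction u) (use g_J J_subset_B in auto)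

lemma G_in_J: "set u \<subseteq> {1..p} \<Longrightarrow> u \<noteq> [] \<Longrightarrow> t \<in> B \<Longrightarrow> G u t \<in> J (hd u)"
  by (cases u) (use g_J G_in_B in auto)

lemma G_cont: "set u \<subseteq> {1..p} \<Longrightarrow> continuous_on B (G u)"
proof (induction u)
  case Nil
  show ?case by (simp add: G_def)
next
  case (Cons i u)
  have "continuous_on B (\<lambda>t. g i (G u t))"
    by (rule continuous_on_compose2[OF g_cont]) (use Cons G_in_B in auto)
  then show ?case by simp
qed

lemma G_inj: "set u \<subseteq> {1..p} \<Longrightarrow> inj_on (G u) B"
proof (induction u)
  case Nil
  show ?case by (rule inj_onI) simp
next
  case (Cons i u)
  have 1: "i \<in> {1..p}" "set u \<subseteq> {1..p}" using Cons.prems by simp_all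
  have "G u ` B \<subseteq> B" using G_in_B[OF 1(2)] by blast
  then have "inj_on (g i) (G u ` B)"
    using g_inj[OF 1(1)] inj_on_subset by blast
  then have "inj_on (g i \<circ> G u) B" by (rule comp_inj_on[OF Cons.IH[OF 1(2)]])
  then show ?case by (simp add: comp_def)
qed

lemma G_deriv:
  "set u \<subseteq> {1..p} \<Longrightarrow> t \<in> B \<Longrightarrow> (G u has_real_derivative Gd u t) (at t within B)"
proof (induction u)
  case Nil
  have "G [] = (\<lambda>t. t)" by (auto simp: G_def)
  then show ?case by simp
next
  case (Cons i u)
  have eq: "G (i # u) = g i \<circ> G u" by (auto simp: fun_eq_iff)
  have "(g i has_real_derivative gd i (G u t)) (at (G u t) within G u ` B)"
    using gd_props(1)[of i "G u t"] Cons.prems G_in_B[of u]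
    by (auto intro!: DERIV_subset[where s = B])
  moreover have "(G u has_real_derivative Gd u t) (at t within B)"
    using Cons by simp
  ultimately show ?case
    unfolding eq Gd.simps by (rule DERIV_image_chain)
qed

lemma Gd_nonzero: "set u \<subseteq> {1..p} \<Longrightarrow> t \<in> B \<Longrightarrow> Gd u t \<noteq> 0"
  by (induction u) (use gd_props(2) G_in_B in auto)

lemma Gd_cont: "set u \<subseteq> {1..p} \<Longrightarrow> continuous_on B (Gd u)"
proof (induction u)
  case Nil
  then show ?case by simp
next
  case (Cons i u)
  have "continuous_on B (\<lambda>t. gd i (G u t))"
    by (rule continuous_on_compose2[OF gd_cont]) (use Cons G_in_B G_cont in auto)
  then show ?case using Cons by (simp add: continuous_on_mult)
qed

lemma Gd_append: "Gd (u @ v) t = Gd u (G v t) * Gd v t"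
  by (induction u) (auto simp: G_append)

lemma segment_in_J:
  "j \<in> {1..p} \<Longrightarrow> t1 \<in> J j \<Longrightarrow> t2 \<in> J j \<Longrightarrow> closed_segment t1 t2 \<subseteq> J j"
  using J_eq by (metis closed_segment_subset convex_real_interval(5))

text \<open>\<open>base p J\<close> is a disjoint union of intervals, so the mean value theorem is
  available only for two points of the same \<open>J j\<close>.\<close>

lemma G_MVT:
  assumes u: "set u \<subseteq> {1..p}" and j: "j \<in> {1..p}" and t: "t1 \<in> J j" "t2 \<in> J j"
  obtains \<xi> where "\<xi> \<in> closed_segment t1 t2" "\<bar>G u t1 - G u t2\<bar> = \<bar>Gd u \<xi>\<bar> * \<bar>t1 - t2\<bar>"
proof -
  have main: "\<exists>\<xi>\<in>closed_segment a b. \<bar>G u a - G u b\<bar> = \<bar>Gd u \<xi>\<bar> * \<bar>a - b\<bar>"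
    if "a \<le> b" "a \<in> J j" "b \<in> J j" for a b
  proof -
    have sub: "{a..b} \<subseteq> B"
      using segment_in_J[OF j that(2,3)] that(1) J_subset_B[OF j]
      by (auto simp: closed_segment_eq_real_ivl)
    have "\<exists>\<xi>\<in>{a..b}. G u b - G u a = (*) (Gd u \<xi>) (b - a)"
    proof (rule mvt_very_simple[OF that(1)])
      fix x assume "a \<le> x" "x \<le> b"
      then have "x \<in> B" using sub by auto
      then have "(G u has_real_derivative Gd u x) (at x within {a..b})"
        using G_deriv[OF u] sub DERIV_subset by blast
      then show "(G u has_derivative (*) (Gd u x)) (at x within {a..b})"
        by (simp add: has_field_derivative_def)
    qed
    then obtain \<xi> where \<xi>: "\<xi> \<in> {a..b}" "G u b - G u a = Gd u \<xi> * (b - a)"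
      by auto
    have "\<bar>G u a - G u b\<bar> = \<bar>Gd u \<xi>\<bar> * \<bar>a - b\<bar>"
      using arg_cong[OF \<xi>(2), of abs] unfolding abs_mult by (simp only: abs_minus_commute)
    then show ?thesis
      using that(1) \<xi>(1) by (intro bexI[of _ \<xi>]) (simp_all add: closed_segment_eq_real_ivl)
  qed
  show ?thesis
  proof (cases "t1 \<le> t2")
    case True
    then show ?thesis using main[of t1 t2] t that by auto
  next
    case False
    then show ?thesis using main[of t2 t1] t that
      by (auto simp: abs_minus_commute closed_segment_commute)
  qed
qed

lemma G_segment:
  assumes u: "set u \<subseteq> {1..p}" and j: "j \<in> {1..p}" and t: "t1 \<in> J j" "t2 \<in> J j"
  shows "G u ` closed_segment t1 t2 = closed_segment (G u t1) (G u t2)"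
proof (rule injective_image_closed_segment)
  have sub: "{lo j..hi j} \<subseteq> B" using J_subset_B[OF j] J_eq[OF j] by simp
  show "continuous_on {lo j..hi j} (G u)"
    by (rule continuous_on_subset[OF G_cont[OF u] sub])
  show "inj_on (G u) {lo j..hi j}"
    by (rule inj_on_subset[OF G_inj[OF u] sub])
  show "lo j \<le> hi j" using lo_less_hi[OF j] by simp
  show "t1 \<in> {lo j..hi j}" "t2 \<in> {lo j..hi j}" using t J_eq[OF j] by simp_all
qed

section \<open>Bounded distortion\<close>

text \<open>The sum runs over the images under the proper suffixes of the word, because the derivative of a
  composition is evaluated at these points; the total distance of the two orbits therefore controls
  the distortion.\<close>

primrec orbit_dist :: "nat list \<Rightarrow> real \<Rightarrow> real \<Rightarrow> real" where
  "orbit_dist [] t1 t2 = 0"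
| "orbit_dist (i # w) t1 t2 = \<bar>G w t1 - G w t2\<bar> + orbit_dist w t1 t2"

definition distortion_const :: "real \<Rightarrow> bool" where
  "distortion_const L \<longleftrightarrow> L \<ge> 0 \<and> (\<forall>u t1 t2. set u \<subseteq> {1..p} \<longrightarrow> t1 \<in> B \<longrightarrow> t2 \<in> B \<longrightarrow>
     \<bar>Gd u t1\<bar> \<le> \<bar>Gd u t2\<bar> * exp (L * orbit_dist u t1 t2))"

text \<open>By compactness \<open>\<bar>gd i\<bar>\<close> has a positive minimum \<open>c\<close>,
  so the Lipschitz bound on the difference becomes the bound
  \<open>1 + L / c * \<bar>t1 - t2\<bar>\<close> on the quotient. The exponential above it is the
  form that multiplies well along a word.\<close>

lemma gd_distortion:
  assumes i: "i \<in> {1..p}"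
  shows "\<exists>L\<ge>0. \<forall>t1\<in>B. \<forall>t2\<in>B. \<bar>gd i t1\<bar> \<le> \<bar>gd i t2\<bar> * exp (L * \<bar>t1 - t2\<bar>)"
proof (cases "B = {}")
  case True
  then show ?thesis by (intro exI[of _ 0]) simp
next
  case False
  obtain L where L: "L-lipschitz_on B (gd i)" using gd_props(3)[OF i] by blast
  have "continuous_on B (\<lambda>t. \<bar>gd i t\<bar>)"
    using gd_cont[OF i] by (intro continuous_intros)
  from continuous_attains_inf[OF compact_B False this]
  obtain x where x: "x \<in> B" "\<And>t. t \<in> B \<Longrightarrow> \<bar>gd i x\<bar> \<le> \<bar>gd i t\<bar>" by blast
  define c where "c = \<bar>gd i x\<bar>"
  have c: "c > 0" using gd_props(2)[OF i x(1)] by (simp add: c_def)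
  have L0: "L \<ge> 0" using L by (rule lipschitz_on_nonneg)
  show ?thesis
  proof (intro exI[of _ "L / c"] conjI ballI)
    show "L / c \<ge> 0" using L0 c by simp
    fix t1 t2 assume t: "t1 \<in> B" "t2 \<in> B"
    have "\<bar>gd i t1 - gd i t2\<bar> \<le> L * \<bar>t1 - t2\<bar>"
      using lipschitz_onD[OF L t] by (simp add: dist_real_def)
    then have "\<bar>gd i t1\<bar> \<le> \<bar>gd i t2\<bar> + L * \<bar>t1 - t2\<bar>" by simp
    also have "L * \<bar>t1 - t2\<bar> = c * (L / c * \<bar>t1 - t2\<bar>)" using c by simp
    also have "\<dots> \<le> \<bar>gd i t2\<bar> * (L / c * \<bar>t1 - t2\<bar>)"
      using x(2)[OF t(2)] L0 c by (intro mult_right_mono) (auto simp: c_def)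
    also have "\<bar>gd i t2\<bar> + \<bar>gd i t2\<bar> * (L / c * \<bar>t1 - t2\<bar>) = \<bar>gd i t2\<bar> * (1 + L / c * \<bar>t1 - t2\<bar>)"
      by (simp add: distrib_left)
    also have "\<dots> \<le> \<bar>gd i t2\<bar> * exp (L / c * \<bar>t1 - t2\<bar>)"
      by (intro mult_left_mono exp_ge_add_one_self) auto
    finally show "\<bar>gd i t1\<bar> \<le> \<bar>gd i t2\<bar> * exp (L / c * \<bar>t1 - t2\<bar>)" by simp
  qed
qed

text \<open>The one-branch estimates multiply along the chain rule, and their exponents add up to
  \<open>orbit_dist\<close>. As there are finitely many branches, one constant serves words of all
  lengths.\<close>

lemma distortion_const_exists: "\<exists>L. distortion_const L"
proof -
  from gd_distortion have "\<forall>i\<in>{1..p}. \<exists>L\<ge>0. \<forall>t1\<in>B. \<forall>t2\<in>B.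
      \<bar>gd i t1\<bar> \<le> \<bar>gd i t2\<bar> * exp (L * \<bar>t1 - t2\<bar>)" by blast
  then obtain Li where Li: "\<And>i. i \<in> {1..p} \<Longrightarrow> Li i \<ge> 0"
    "\<And>i t1 t2. i \<in> {1..p} \<Longrightarrow> t1 \<in> B \<Longrightarrow> t2 \<in> B \<Longrightarrow>
      \<bar>gd i t1\<bar> \<le> \<bar>gd i t2\<bar> * exp (Li i * \<bar>t1 - t2\<bar>)"
    by metis
  define L where "L = (\<Sum>i\<in>{1..p}. Li i)"
  have L0: "L \<ge> 0" unfolding L_def using Li(1) by (intro sum_nonneg)
  have LiL: "Li i \<le> L" if "i \<in> {1..p}" for i
    unfolding L_def using Li(1) that by (intro member_le_sum) auto
  have "\<bar>Gd u t1\<bar> \<le> \<bar>Gd u t2\<bar> * exp (L * orbit_dist u t1 t2)"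
    if "set u \<subseteq> {1..p}" "t1 \<in> B" "t2 \<in> B" for u t1 t2
    using that(1)
  proof (induction u)
    case Nil
    show ?case by simp
  next
    case (Cons i u)
    have i: "i \<in> {1..p}" and u: "set u \<subseteq> {1..p}" using Cons.prems by simp_all
    have "\<bar>gd i (G u t1)\<bar> \<le> \<bar>gd i (G u t2)\<bar> * exp (Li i * \<bar>G u t1 - G u t2\<bar>)"
      using Li(2)[OF i] G_in_B[OF u] that by blast
    also have "\<dots> \<le> \<bar>gd i (G u t2)\<bar> * exp (L * \<bar>G u t1 - G u t2\<bar>)"
      using LiL[OF i] by (intro mult_left_mono) (auto intro: mult_right_mono)
    finally have "\<bar>gd i (G u t1)\<bar> * \<bar>Gd u t1\<bar> \<le>
        \<bar>gd i (G u t2)\<bar> * exp (L * \<bar>G u t1 - G u t2\<bar>) * (\<bar>Gd u t2\<bar> * exp (L * orbit_dist u t1 t2))"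
      using Cons.IH[OF u] by (intro mult_mono) auto
    then show ?case by (simp add: abs_mult distrib_left exp_add mult_ac)
  qed
  then show ?thesis using L0 unfolding distortion_const_def by blast
qed

lemma distortion:
  "distortion_const L \<Longrightarrow> set u \<subseteq> {1..p} \<Longrightarrow> t1 \<in> B \<Longrightarrow> t2 \<in> B \<Longrightarrow>
     \<bar>Gd u t1\<bar> \<le> \<bar>Gd u t2\<bar> * exp (L * orbit_dist u t1 t2)"
  by (simp add: distortion_const_def)

section \<open>Cylinders\<close>

lemma cyl_snoc: "cyl (u @ [j]) = G u ` J j"
  by (simp add: cylinder_def G_def)

lemma cyl_single: "cyl [j] = J j"
  using cyl_snoc[of "[]" j] by simp

lemma cyl_append: "w \<noteq> [] \<Longrightarrow> cyl (u @ w) = G u ` cyl w"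
proof (induction w rule: rev_induct)
  case (snoc j w)
  show ?case using cyl_snoc[of "u @ w" j] by (simp add: cyl_snoc image_image G_append)
qed simp

lemma cyl_Cons: "w \<noteq> [] \<Longrightarrow> cyl (i # w) = g i ` cyl w"
  using cyl_append[of w "[i]"] by simp

lemma cyl_J_hd: assumes "set w \<subseteq> {1..p}" "w \<noteq> []" shows "cyl w \<subseteq> J (hd w)"
proof (cases w rule: rev_cases)
  case (snoc u j)
  show ?thesis
  proof (cases "u = []")
    case True
    then show ?thesis using snoc by (simp add: cyl_single)
  next
    case False
    have "G u t \<in> J (hd u)" if "t \<in> J j" for t
      using that G_in_J[of u t] J_subset_B[of j] assms(1) snoc False by auto
    then show ?thesis using snoc False by (auto simp: cyl_snoc)
  qed
qed (use assms in simp)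

lemma hd_in_alphabet: "set w \<subseteq> {1..p} \<Longrightarrow> w \<noteq> [] \<Longrightarrow> hd w \<in> {1..p}"
  by (cases w) auto

lemma cyl_subset_B: "set w \<subseteq> {1..p} \<Longrightarrow> w \<noteq> [] \<Longrightarrow> cyl w \<subseteq> B"
  using cyl_J_hd J_subset_B hd_in_alphabet by blast

lemma cyl_mono: 
  assumes "set (v @ r) \<subseteq> {1..p}" "v \<noteq> []" shows "cyl (v @ r) \<subseteq> cyl v"
proof (cases v rule: rev_cases)
  case (snoc u j)
  have "cyl (j # r) \<subseteq> J j" using cyl_J_hd[of "j # r"] assms snoc by simp
  then show ?thesis
    using snoc cyl_append[of "j # r" u] by (auto simp: cyl_snoc)
qed (use assms in simp)

text \<open>A point determines its letters one after the other, since the intervals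
  \<open>J i\<close> are disjoint and the branches injective. Two cylinders are therefore disjoint
  unless one word is a prefix of the other.\<close>

lemma cyl_meet_prefix:
  assumes "set u \<subseteq> {1..p}" "set v \<subseteq> {1..p}" "u \<noteq> []" "length u \<le> length v" "t \<in> cyl u" "t \<in> cyl v"
  shows "u = take (length u) v"
  using assms
proof (induction u arbitrary: v t)
  case (Cons i u)
  then obtain k v' where v: "v = k # v'" by (cases v) auto
  have "t \<in> J i" "t \<in> J k"
    using cyl_J_hd[of "i # u"] cyl_J_hd[of v] Cons.prems v by auto
  then have ik: "i = k" using J_disjoint Cons.prems v by auto
  show ?case
  proof (cases "u = []")
    case False
    then have v': "v' \<noteq> []" using Cons.prems v by auto
    obtain t1 t2 where t: "t1 \<in> cyl u" "t = g i t1" "t2 \<in> cyl v'" "t = g i t2"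
      using Cons.prems(5,6) v ik False v' by (auto simp: cyl_Cons)
    have "t1 \<in> B" "t2 \<in> B"
      using cyl_subset_B[of u] cyl_subset_B[of v'] t False v' Cons.prems v by auto
    then have "t1 = t2"
      using g_inj[of i] t(2,4) Cons.prems(1) by (auto dest: inj_onD)
    then have "u = take (length u) v'"
      using Cons.IH[of v' t1] t Cons.prems v False by auto
    then show ?thesis using v ik by simp
  qed (simp add: v ik)
qed simp

lemma cyl_segment:
  assumes "set u \<subseteq> {1..p}" "j \<in> {1..p}"
  shows "cyl (u @ [j]) = closed_segment (G u (lo j)) (G u (hi j))"
proof -
  have "J j = closed_segment (lo j) (hi j)"
    using J_eq[OF assms(2)] lo_less_hi[OF assms(2)] by (simp add: closed_segment_eq_real_ivl)
  moreover have "lo j \<in> J j" "hi j \<in> J j"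
    using J_eq[OF assms(2)] lo_less_hi[OF assms(2)] by auto
  ultimately show ?thesis
    using G_segment[OF assms, of "lo j" "hi j"] by (simp add: cyl_snoc)
qed

lemma cyl_interval:
  assumes "set w \<subseteq> {1..p}" "w \<noteq> []"
  obtains a b where "a < b" "cyl w = {a..b}"
proof -
  obtain u j where w: "w = u @ [j]" using assms(2) by (cases w rule: rev_cases) auto
  have u: "set u \<subseteq> {1..p}" and j: "j \<in> {1..p}" using assms(1) w by auto
  have e: "lo j \<in> B" "hi j \<in> B" using J_eq[OF j] lo_less_hi[OF j] J_subset_B[OF j] by auto
  then have "G u (lo j) \<noteq> G u (hi j)"
    using G_inj[OF u] lo_less_hi[OF j] by (metis inj_onD less_irrefl)
  then show ?thesis
    using cyl_segment[OF u j] that w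
    by (cases "G u (lo j) < G u (hi j)") (auto simp: closed_segment_eq_real_ivl split: if_splits)
qed

lemma cyl_small:
  assumes "\<epsilon> > 0"
  obtains N where "\<And>w t1 t2. set w \<subseteq> {1..p} \<Longrightarrow> length w \<ge> N \<Longrightarrow> t1 \<in> cyl w \<Longrightarrow> t2 \<in> cyl w \<Longrightarrow> \<bar>t1 - t2\<bar> < \<epsilon>"
proof -
  let ?d = "\<lambda>n. Max ((\<lambda>w. diameter (cyl w)) ` words p n)"
  have "\<forall>\<^sub>F n in sequentially. \<bar>?d n\<bar> < \<epsilon>"
    using tendstoD[OF expands[unfolded expansive_def] assms] by (simp add: dist_real_def)
  then obtain N where N: "\<And>n. n \<ge> N \<Longrightarrow> \<bar>?d n\<bar> < \<epsilon>"
    by (auto simp: eventually_sequentially)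
  \<comment> \<open>The maximum with 1 excludes the empty word, whose cylinder has no
    meaning.\<close>
  show ?thesis
  proof (rule that[of "max N 1"])
    fix w t1 t2
    assume w: "set w \<subseteq> {1..p}" "length w \<ge> max N 1" and t: "t1 \<in> cyl w" "t2 \<in> cyl w"
    have "finite (words p (length w))"
      unfolding words_def using finite_lists_length_eq[of "{1..p}"] by simp
    then have "diameter (cyl w) \<le> ?d (length w)"
      using w by (intro Max_ge) (auto simp: words_def)
    also have "\<dots> < \<epsilon>" using N[of "length w"] w by simp
    finally have d: "diameter (cyl w) < \<epsilon>" .
    have "w \<noteq> []" using w by auto
    then obtain a b where "cyl w = {a..b}" using cyl_interval[OF w(1)] by blast
    then have "dist t1 t2 \<le> diameter (cyl w)"
      using t by (intro diameter_bounded_bound) auto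
    then show "\<bar>t1 - t2\<bar> < \<epsilon>" using d by (simp add: dist_real_def)
  qed
qed

section \<open>Iterates of the expanding map\<close>

lemma markov_map_g: assumes i: "i \<in> {1..p}" and t: "t \<in> B" shows "f (g i t) = t"
proof -
  \<comment> \<open>The range of every \<open>g k\<close> lies in \<open>J k\<close>, and these
    intervals are disjoint.\<close>
  have "(THE k. k \<in> {1..p} \<and> g i t \<in> g k ` B) = i"
  proof (rule the_equality)
    show "i \<in> {1..p} \<and> g i t \<in> g i ` B" using i t by blast
    fix k assume k: "k \<in> {1..p} \<and> g i t \<in> g k ` B"
    then obtain t' where "t' \<in> B" "g i t = g k t'" by auto
    then have "g i t \<in> J k" using g_J[of k t'] k by simp
    then show "k = i" using J_disjoint g_J[OF i t] k i by blast
  qed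
  then show ?thesis
    unfolding markov_map_def by (simp add: inv_into_f_f[OF g_inj[OF i] t])
qed

lemma iterate_G:
  assumes "set u \<subseteq> {1..p}" "t \<in> B" "j \<le> length u"
  shows "(f ^^ j) (G u t) = G (drop j u) t"
  using assms
proof (induction j arbitrary: u)
  case (Suc j)
  then obtain i v where u: "u = i # v" by (cases u) auto
  have "f (G u t) = G v t" using markov_map_g[of i "G v t"] G_in_B[of v] Suc.prems u by auto
  then show ?case using Suc u by (simp add: funpow_swap1)
qed simp

lemma iterate_defined_G:
  assumes "set u \<subseteq> {1..p}" "Z \<subseteq> G u ` B"
  shows "iterate_defined_on p J g (length u) Z"
  unfolding iterate_defined_on_def
proof (intro ballI allI impI)
  fix z j assume "z \<in> Z" and j: "j < length u"
  then obtain t where t: "t \<in> B" "z = G u t" using assms(2) by blast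
  have "drop j u = u ! j # drop (Suc j) u" using j by (simp add: Cons_nth_drop_Suc)
  then have "(f ^^ j) z = g (u ! j) (G (drop (Suc j) u) t)"
    using iterate_G[OF assms(1) t(1)] j t(2) by simp
  moreover have "G (drop (Suc j) u) t \<in> B"
    using G_in_B t(1) assms(1) set_drop_subset by (metis subset_trans)
  moreover have "u ! j \<in> {1..p}" using assms(1) j nth_mem by blast
  ultimately show "(f ^^ j) z \<in> markov_dom p J g" unfolding markov_dom_def by blast
qed

text \<open>On \<open>J j\<close> the iterate is a left inverse of \<open>G u\<close>, so the
  inverse function rule applies. For interior \<open>t\<close> the derivative within
  \<open>base p J\<close> is two-sided and \<open>G u t\<close> is interior to the image.\<close>

lemma iterate_deriv:
  assumes u: "set u \<subseteq> {1..p}" and j: "j \<in> {1..p}" and t: "lo j < t" "t < hi j"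
  shows "DERIV (f ^^ length u) (G u t) :> inverse (Gd u t)"
proof -
  let ?h = "f ^^ length u"
  have ends: "lo j \<in> J j" "hi j \<in> J j" "t \<in> J j"
    using J_eq[OF j] t by auto
  have seg: "J j = closed_segment (lo j) (hi j)"
    using J_eq[OF j] lo_less_hi[OF j] by (simp add: closed_segment_eq_real_ivl)
  have inv: "?h (G u y) = y" if "y \<in> J j" for y
    using iterate_G[OF u, of y "length u"] J_subset_B[OF j] that by auto
  have img: "G u ` J j = closed_segment (G u (lo j)) (G u (hi j))"
    using G_segment[OF u j ends(1,2)] seg by simp
  have ne: "G u t \<noteq> G u (lo j)" "G u t \<noteq> G u (hi j)"
    using inv[OF ends(1)] inv[OF ends(2)] inv[OF ends(3)] t by auto
  define a b where "a = min (G u (lo j)) (G u (hi j))" and "b = max (G u (lo j)) (G u (hi j))"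
  have img': "G u ` J j = {a..b}"
    unfolding img a_def b_def by (auto simp: closed_segment_eq_real_ivl)
  then have "G u t \<in> {a..b}" using ends(3) by blast
  then have ab: "a < G u t" "G u t < b"
    using ne by (auto simp: a_def b_def min_def max_def split: if_splits)
  have cont: "continuous_on {a..b} ?h"
    unfolding img'[symmetric]
  proof (rule continuous_on_inv)
    show "continuous_on (J j) (G u)"
      using G_cont[OF u] J_subset_B[OF j] continuous_on_subset by blast
    show "compact (J j)" using J_eq[OF j] by simp
    show "\<forall>x\<in>J j. ?h (G u x) = x" using inv by blast
  qed
  have gc: "isCont ?h (G u t)"
    by (rule continuous_on_interior[OF cont]) (use ab in simp)
  have "t \<in> B" using J_subset_B[OF j] ends(3) by blast
  moreover have "{lo j<..<hi j} \<subseteq> B"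
    using J_subset_B[OF j] J_eq[OF j] greaterThanLessThan_subseteq_atLeastAtMost_iff by blast
  ultimately have "(G u has_real_derivative Gd u t) (at t within {lo j<..<hi j})"
    using DERIV_subset[OF G_deriv[OF u]] by blast
  then have d: "DERIV (G u) (?h (G u t)) :> Gd u t"
    using t inv[OF ends(3)] at_within_open[of t "{lo j<..<hi j}"] by simp
  have "Gd u t \<noteq> 0" using Gd_nonzero[OF u] J_subset_B[OF j] ends(3) by blast
  moreover have "G u (?h y) = y" if "a < y" "y < b" for y
  proof -
    have "y \<in> G u ` J j" using that img' by simp
    then show ?thesis using inv by auto
  qed
  ultimately show ?thesis
    using DERIV_inverse_function[OF d _ ab _ gc] by blast
qed

text \<open>Each \<open>g i\<close> maps a compact set into the interior of \<open>J i\<close>, so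
  the distance to the two ends has a positive minimum. Orbit points thus stay uniformly away from
  the ends of their intervals.\<close>

lemma g_margin: 
  obtains \<delta> where "\<delta> > 0" "\<And>i t. i \<in> {1..p} \<Longrightarrow> t \<in> B \<Longrightarrow> lo i + \<delta> \<le> g i t \<and> g i t \<le> hi i - \<delta>"
proof -
  have "\<forall>i\<in>{1..p}. \<exists>\<delta>>0. \<forall>t\<in>B. lo i + \<delta> \<le> g i t \<and> g i t \<le> hi i - \<delta>"
  proof
    fix i assume i: "i \<in> {1..p}"
    have ne: "B \<noteq> {}" using J_subset_B[OF i] J_eq[OF i] lo_less_hi[OF i] by auto
    obtain u where u: "u \<in> B" "\<And>t. t \<in> B \<Longrightarrow> g i u \<le> g i t"
      using continuous_attains_inf[OF compact_B ne g_cont[OF i]] by blast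
    obtain v where v: "v \<in> B" "\<And>t. t \<in> B \<Longrightarrow> g i t \<le> g i v"
      using continuous_attains_sup[OF compact_B ne g_cont[OF i]] by blast
    have "g i u > lo i" "g i v < hi i"
      using g_interior[OF i u(1)] g_interior[OF i v(1)] J_eq[OF i] by auto
    moreover have "lo i + min (g i u - lo i) (hi i - g i v) \<le> g i t \<and>
        g i t \<le> hi i - min (g i u - lo i) (hi i - g i v)" if "t \<in> B" for t
      using u(2)[OF that] v(2)[OF that] by linarith
    ultimately show "\<exists>\<delta>>0. \<forall>t\<in>B. lo i + \<delta> \<le> g i t \<and> g i t \<le> hi i - \<delta>"
      by (intro exI[of _ "min (g i u - lo i) (hi i - g i v)"]) simp
  qed
  then obtain \<delta> where \<delta>: "\<And>i. i \<in> {1..p} \<Longrightarrow> \<delta> i > 0"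
    "\<And>i t. i \<in> {1..p} \<Longrightarrow> t \<in> B \<Longrightarrow> lo i + \<delta> i \<le> g i t \<and> g i t \<le> hi i - \<delta> i" by metis
  have ne: "{1..p} \<noteq> {}" using system unfolding markov_system_def by auto
  show ?thesis
  proof (rule that[of "Min (\<delta> ` {1..p})"])
    show "Min (\<delta> ` {1..p}) > 0" using \<delta>(1) ne by (subst Min_gr_iff) auto
    fix i t assume i: "i \<in> {1..p}" "t \<in> B"
    have "Min (\<delta> ` {1..p}) \<le> \<delta> i" using i(1) by (intro Min_le) auto
    then show "lo i + Min (\<delta> ` {1..p}) \<le> g i t \<and> g i t \<le> hi i - Min (\<delta> ` {1..p})"
      using \<delta>(2)[OF i] by auto
  qed
qed

end

section \<open>The orbit of a coded point and the inverse branches along it\<close>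

locale markov_orbit = markov +
  fixes s :: "nat \<Rightarrow> nat"
  assumes s_range: "range s \<subseteq> {1..p}"
begin

text \<open>\<open>P j n\<close> is the inverse branch of the \<open>(n - j)\<close>-th iterate that takes \<open>y n\<close> back to \<open>y j\<close>.\<close>

definition P :: "nat \<Rightarrow> nat \<Rightarrow> real \<Rightarrow> real" where
  "P j n = G (map s [j..<n])"

text \<open>Given by the codings of the tails, which makes membership in cylinders immediate;
  \<open>iterate_y\<close> identifies these points with the orbit of \<open>y 0\<close>.\<close>

definition y :: "nat \<Rightarrow> real" where
  "y n = coding J g (\<lambda>k. s (n + k))"

lemma s_in: "s n \<in> {1..p}"
  using s_range by blast

lemma s_word: "set (map s xs) \<subseteq> {1..p}"
  using s_range by auto

lemma map_upt_Cons: "j < n \<Longrightarrow> map s [j..<n] = s j # map s [Suc j..<n]"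
  by (simp add: upt_conv_Cons)

lemma map_upt_append: "j \<le> m \<Longrightarrow> m \<le> n \<Longrightarrow> map s [j..<n] = map s [j..<m] @ map s [m..<n]"
  using upt_add_eq_append[of j m "n - m"] by simp

lemma P_same [simp]: "P n n t = t"
  by (simp add: P_def)

lemma P_step: "j < n \<Longrightarrow> P j n t = g (s j) (P (Suc j) n t)"
  by (simp add: P_def map_upt_Cons)

lemma P_comp: "j \<le> m \<Longrightarrow> m \<le> n \<Longrightarrow> P j n t = P j m (P m n t)"
  unfolding P_def using map_upt_append[of j m n] by (simp add: G_append)

lemma P_in_B: "t \<in> B \<Longrightarrow> P j n t \<in> B"
  unfolding P_def by (rule G_in_B[OF s_word])

lemma P_image_cyl:
  assumes "j \<le> n" "l > 0" shows "P j n ` cyl (map s [n..<n + l]) = cyl (map s [j..<n + l])"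
  using cyl_append[of "map s [n..<n + l]" "map s [j..<n]"] map_upt_append[of j n "n + l"] assms
  by (simp add: P_def)

lemma cyl_decreasing:
  assumes "0 < k" "k \<le> l" shows "cyl (map s [n..<n + l]) \<subseteq> cyl (map s [n..<n + k])"
proof -
  have "map s [n..<n + l] = map s [n..<n + k] @ map s [n + k..<n + l]"
    using assms by (intro map_upt_append) auto
  then show ?thesis
    using cyl_mono[of "map s [n..<n + k]" "map s [n + k..<n + l]"] assms s_word
    by (simp only: map_append[symmetric] list.map_disc_iff) simp
qed

text \<open>Nested compact intervals have a common point, and shrinking diameters leave no second
  one. This gives \<open>the_elem\<close> in \<open>coding\<close> its meaning.\<close>

lemma y_singleton: "(\<Inter>l\<in>{1..}. cyl (map s [n..<n + l])) = {y n}"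
proof -
  let ?C = "\<lambda>l. cyl (map s [n..<n + Suc l])"
  have eq: "(\<Inter>l\<in>{1..}. cyl (map s [n..<n + l])) = (\<Inter>l. ?C l)"
  proof (intro equalityI subsetI INT_I)
    fix t and l :: nat assume "t \<in> (\<Inter>l. ?C l)" "l \<in> {1..}"
    then have "t \<in> ?C (l - 1)" "Suc (l - 1) = l" by (blast, simp)
    then show "t \<in> cyl (map s [n..<n + l])" by simp
  next
    fix t and l :: nat assume "t \<in> (\<Inter>l\<in>{1..}. cyl (map s [n..<n + l]))"
    moreover have "Suc l \<in> {1..}" by simp
    ultimately show "t \<in> ?C l" by blast
  qed
  have "(\<Inter>l. ?C l) \<noteq> {}"
  proof (rule compact_nest)
    fix l
    obtain a b where "a < b" "?C l = {a..b}"
      by (rule cyl_interval[of "map s [n..<n + Suc l]", OF s_word]) simp_all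
    then show "compact (?C l)" "?C l \<noteq> {}" by (auto simp del: upt_Suc)
  next
    fix k l :: nat assume "k \<le> l"
    then show "?C l \<subseteq> ?C k" using cyl_decreasing[of "Suc k" "Suc l"] by simp
  qed
  then obtain t where t: "t \<in> (\<Inter>l. ?C l)" by blast
  have "t' = t" if "t' \<in> (\<Inter>l. ?C l)" for t'
  proof (rule ccontr)
    assume "t' \<noteq> t"
    then have "\<bar>t' - t\<bar> > 0" by simp
    from cyl_small[OF this] obtain N where N: "\<And>w t1 t2. set w \<subseteq> {1..p} \<Longrightarrow> length w \<ge> N \<Longrightarrow>
        t1 \<in> cyl w \<Longrightarrow> t2 \<in> cyl w \<Longrightarrow> \<bar>t1 - t2\<bar> < \<bar>t' - t\<bar>" by blast
    have "t' \<in> ?C N" "t \<in> ?C N" using t that by blast+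
    then show False using N[OF s_word, of "[n..<n + Suc N]" t' t] by simp
  qed
  then have *: "(\<Inter>l. ?C l) = {t}" using t by blast
  have shift: "map (\<lambda>k. s (n + k)) [0..<l] = map s [n..<n + l]" for l
    by (rule nth_equalityI) auto
  have "y n = the_elem (\<Inter>l\<in>{1..}. cyl (map s [n..<n + l]))"
    unfolding y_def coding_def shift by simp
  then show ?thesis unfolding eq * by simp
qed

lemma y_cyl: "l > 0 \<Longrightarrow> y n \<in> cyl (map s [n..<n + l])"
  using y_singleton[of n] by fastforce

lemma y_unique: "(\<And>l. l > 0 \<Longrightarrow> t \<in> cyl (map s [n..<n + l])) \<Longrightarrow> t = y n"
  using y_singleton[of n] by (metis INT_I One_nat_def Suc_le_eq atLeast_iff singletonD)

lemma y_J: "y n \<in> J (s n)"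
  using y_cyl[of 1 n] by (simp add: cyl_single)

lemma y_B: "y n \<in> B"
  using y_J J_subset_B[OF s_in] by blast

lemma y_step: "y n = g (s n) (y (Suc n))"
proof (rule y_unique[symmetric])
  fix l :: nat assume l: "l > 0"
  have "map s [n..<n + Suc l] = s n # map s [Suc n..<Suc n + l]" by (subst map_upt_Cons) auto
  then have "cyl (map s [n..<n + Suc l]) = g (s n) ` cyl (map s [Suc n..<Suc n + l])"
    using l by (simp add: cyl_Cons)
  then have "g (s n) (y (Suc n)) \<in> cyl (map s [n..<n + Suc l])" using y_cyl[OF l, of "Suc n"] by (simp del: upt_Suc add_Suc_right)
  then show "g (s n) (y (Suc n)) \<in> cyl (map s [n..<n + l])"
    using cyl_decreasing[of l "Suc l"] l by auto
qed

lemma y_P: "j \<le> n \<Longrightarrow> y j = P j n (y n)"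
proof (induction j rule: inc_induct)
  case (step m)
  then show ?case using y_step[of m] by (simp add: P_step)
qed simp

lemma f_y: "f (y n) = y (Suc n)"
  using markov_map_g[OF s_in y_B] y_step by metis

lemma iterate_y: "(f ^^ k) (y n) = y (n + k)"
  by (induction k) (auto simp: f_y)

text \<open>Turns the distortion exponent into a total length of pullbacks. Time \<open>j\<close> is
  left out and time \<open>n\<close> is included because \<open>g (s j)\<close> is differentiated at
  the points of time \<open>j + 1\<close>.\<close>

lemma orbit_dist_sum:
  "j \<le> n \<Longrightarrow> orbit_dist (map s [j..<n]) t1 t2 = (\<Sum>k\<in>{Suc j..n}. \<bar>P k n t1 - P k n t2\<bar>)"
proof (induction j rule: inc_induct)
  case (step m)
  have "{Suc m..n} = insert (Suc m) {Suc (Suc m)..n}" using step by auto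
  then show ?case using step by (simp add: map_upt_Cons P_def)
qed simp

lemma P_diff_le_len: "t1 \<in> B \<Longrightarrow> t2 \<in> B \<Longrightarrow> \<bar>P k n t1 - P k n t2\<bar> \<le> len"
  by (intro abs_diff_le_len P_in_B)

lemma P_sum_le_len:
  assumes "t1 \<in> B" "t2 \<in> B" shows "(\<Sum>k\<in>F. \<bar>P k n t1 - P k n t2\<bar>) \<le> card F * len"
  using sum_bounded_above[of F "\<lambda>k. \<bar>P k n t1 - P k n t2\<bar>" len] P_diff_le_len[OF assms] by simp

lemma len_nonneg: "len \<ge> 0"
  by (metis I_interval)

section \<open>Bounded total pullback length implies membership in H\<close>

lemma P_MVT:
  assumes "t1 \<in> J (s n)" "t2 \<in> J (s n)"
  obtains \<xi> where "\<xi> \<in> J (s n)" "\<bar>P j n t1 - P j n t2\<bar> = \<bar>Gd (map s [j..<n]) \<xi>\<bar> * \<bar>t1 - t2\<bar>"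
  using G_MVT[OF s_word s_in assms, of "[j..<n]"] segment_in_J[OF s_in assms] unfolding P_def
  by (metis subsetD)

lemma Gd_y_pos: "\<bar>Gd (map s [j..<n]) (y n)\<bar> > 0"
  using Gd_nonzero[OF s_word y_B] by simp

lemma iterate_P:
  assumes "t \<in> B" shows "(f ^^ n) (P 0 n t) = t"
  using iterate_G[OF s_word assms, of n "[0..<n]"] by (simp add: P_def)

lemma iterate_deriv_P:
  assumes "lo (s n) < t" "t < hi (s n)"
  shows "DERIV (f ^^ n) (P 0 n t) :> inverse (Gd (map s [0..<n]) t)"
  using iterate_deriv[OF s_word s_in assms, of "[0..<n]"] by (simp add: P_def)

lemma cyl_P: "cyl (map s [j..<n] @ [s n]) = P j n ` J (s n)"
  by (simp add: cyl_snoc P_def)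

text \<open>The ends of \<open>J (s n)\<close> are at least \<delta> away from \<open>y n\<close>.
  With distortion at most \<open>K\<close> they are pulled back to distance at least
  \<open>r\<close> from \<open>y 0\<close>, so the ball lies in the pullback of
  \<open>J (s n)\<close> and inherits the distortion bound.\<close>

lemma hyperbolic_time:
  assumes L: "distortion_const L" and \<delta>: "\<delta> > 0" "lo (s n) + \<delta> \<le> y n" "y n \<le> hi (s n) - \<delta>"
    and C: "\<And>t1 t2. t1 \<in> J (s n) \<Longrightarrow> t2 \<in> J (s n) \<Longrightarrow> (\<Sum>k\<in>{..n}. \<bar>P k n t1 - P k n t2\<bar>) \<le> C"
  defines "K \<equiv> exp (L * C)" and "lam \<equiv> \<bar>Gd (map s [0..<n]) (y n)\<bar>"
  defines "r \<equiv> \<delta> * lam / K"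
  shows "ball (y 0) r \<subseteq> P 0 n ` {lo (s n)<..<hi (s n)}"
    and "iterate_defined_on p J g n (ball (y 0) r)"
    and "diameter ((f ^^ n) ` ball (y 0) r) > \<delta> / (4 * K\<^sup>2)"
    and "Dist (f ^^ n) (ball (y 0) r) < ereal (K\<^sup>2 + 1)"
proof -
  have K: "K > 0" by (simp add: K_def)
  have lam: "lam > 0" unfolding lam_def by (rule Gd_y_pos)
  have r: "r > 0" using \<delta> lam K by (simp add: r_def)
  have dist: "\<bar>Gd (map s [0..<n]) t1\<bar> \<le> \<bar>Gd (map s [0..<n]) t2\<bar> * K"
    if "t1 \<in> J (s n)" "t2 \<in> J (s n)" for t1 t2
  proof -
    have "\<bar>Gd (map s [0..<n]) t1\<bar> \<le> \<bar>Gd (map s [0..<n]) t2\<bar> * exp (L * orbit_dist (map s [0..<n]) t1 t2)"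
      using distortion[OF L s_word] that J_subset_B[OF s_in] by blast
    moreover have "orbit_dist (map s [0..<n]) t1 t2 \<le> (\<Sum>k\<in>{..n}. \<bar>P k n t1 - P k n t2\<bar>)"
      using orbit_dist_sum[of 0 n t1 t2] by (auto intro: sum_mono2)
    then have "exp (L * orbit_dist (map s [0..<n]) t1 t2) \<le> K"
      using C[OF that] L unfolding K_def distortion_const_def by (auto intro: mult_left_mono order_trans)
    ultimately show ?thesis by (meson abs_ge_zero mult_left_mono order_trans)
  qed
  have y0: "y 0 = P 0 n (y n)" by (rule y_P) simp
  have far: "r \<le> \<bar>P 0 n e - y 0\<bar>" if e: "e \<in> J (s n)" and ey: "\<delta> \<le> \<bar>e - y n\<bar>" for e
  proof -
    obtain \<xi> where \<xi>: "\<xi> \<in> J (s n)" "\<bar>P 0 n e - y 0\<bar> = \<bar>Gd (map s [0..<n]) \<xi>\<bar> * \<bar>e - y n\<bar>"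
      using P_MVT[OF e y_J] y0 by metis
    have "lam / K \<le> \<bar>Gd (map s [0..<n]) \<xi>\<bar>"
      using dist[OF y_J \<xi>(1)] K by (simp add: lam_def divide_le_eq)
    then have "lam / K * \<delta> \<le> \<bar>Gd (map s [0..<n]) \<xi>\<bar> * \<bar>e - y n\<bar>"
      using ey \<delta> by (intro mult_mono) auto
    then show ?thesis using \<xi>(2) by (simp add: r_def mult_ac)
  qed
  have ends: "lo (s n) \<in> J (s n)" "hi (s n) \<in> J (s n)"
    using J_eq[OF s_in] lo_less_hi[OF s_in, of n] by auto
  have far_lo: "r \<le> \<bar>P 0 n (lo (s n)) - y 0\<bar>" and far_hi: "r \<le> \<bar>P 0 n (hi (s n)) - y 0\<bar>"
    using far[OF ends(1)] far[OF ends(2)] \<delta> by auto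
  have "J (s n) = closed_segment (lo (s n)) (hi (s n))"
    using J_eq[OF s_in] lo_less_hi[OF s_in, of n] by (simp add: closed_segment_eq_real_ivl)
  then have img: "P 0 n ` J (s n) = closed_segment (P 0 n (lo (s n))) (P 0 n (hi (s n)))"
    unfolding P_def using G_segment[OF s_word s_in ends] by simp
  have "y 0 \<in> P 0 n ` J (s n)" using y0 y_J by blast
  then have y0_seg: "y 0 \<in> closed_segment (P 0 n (lo (s n))) (P 0 n (hi (s n)))" using img by simp
  show ball: "ball (y 0) r \<subseteq> P 0 n ` {lo (s n)<..<hi (s n)}"
  proof
    fix z assume "z \<in> ball (y 0) r"
    then have z: "\<bar>y 0 - z\<bar> < r" by (simp add: dist_real_def)
    then have "z \<in> closed_segment (P 0 n (lo (s n))) (P 0 n (hi (s n)))"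
      using far_lo far_hi y0_seg by (auto simp: closed_segment_eq_real_ivl split: if_splits)
    then obtain t where t: "t \<in> J (s n)" "z = P 0 n t" using img by (metis imageE)
    have "t \<noteq> lo (s n)" "t \<noteq> hi (s n)" using t z far_lo far_hi by auto
    then show "z \<in> P 0 n ` {lo (s n)<..<hi (s n)}" using t J_eq[OF s_in] by auto
  qed
  have sub_J: "{lo (s n)<..<hi (s n)} \<subseteq> J (s n)" using J_eq[OF s_in] by auto
  have ballB: "ball (y 0) r \<subseteq> P 0 n ` B"
    using ball sub_J J_subset_B[OF s_in, of n] by blast
  then show "iterate_defined_on p J g n (ball (y 0) r)"
    using iterate_defined_G[OF s_word, of "ball (y 0) r" "[0..<n]"] by (simp add: P_def)
  have ball_pt: "\<exists>t. lo (s n) < t \<and> t < hi (s n) \<and> t \<in> J (s n) \<and> z = P 0 n t" if "z \<in> ball (y 0) r" for z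
    using ball that sub_J by fastforce
  have fimg: "(f ^^ n) ` ball (y 0) r \<subseteq> J (s n)"
    using ball_pt iterate_P J_subset_B[OF s_in] by (smt (verit) imageE subset_iff)
  \<comment> \<open>The iterate moves this point at least \<open>\<delta> / (2 * K\<^sup>2)\<close>
    away from \<open>y n\<close>. The lemma claims half of that to make the inequality
    strict.\<close>
  have "y 0 + r / 2 \<in> ball (y 0) r" using r by (simp add: dist_real_def)
  then obtain t where t: "t \<in> J (s n)" "y 0 + r / 2 = P 0 n t" using ball_pt by blast
  obtain \<xi> where \<xi>: "\<xi> \<in> J (s n)" "\<bar>P 0 n t - P 0 n (y n)\<bar> = \<bar>Gd (map s [0..<n]) \<xi>\<bar> * \<bar>t - y n\<bar>"
    using P_MVT[OF t(1) y_J] by metis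
  have "r / 2 = \<bar>Gd (map s [0..<n]) \<xi>\<bar> * \<bar>t - y n\<bar>"
    using \<xi>(2) t(2) y0 r by simp
  also have "\<dots> \<le> lam * K * \<bar>t - y n\<bar>"
    using dist[OF \<xi>(1) y_J] by (intro mult_right_mono) (auto simp: lam_def)
  finally have "\<delta> * lam / K / 2 \<le> lam * K * \<bar>t - y n\<bar>" by (simp add: r_def)
  then have "lam * (\<delta> / (2 * K)) \<le> lam * (K * \<bar>t - y n\<bar>)" by (simp add: mult_ac)
  then have "\<delta> / (2 * K) \<le> K * \<bar>t - y n\<bar>" using lam mult_le_cancel_left_pos by blast
  then have "\<delta> / (2 * K\<^sup>2) \<le> \<bar>t - y n\<bar>" using K by (simp add: field_simps power2_eq_square)
  moreover have "\<bar>t - y n\<bar> \<le> diameter ((f ^^ n) ` ball (y 0) r)"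
  proof -
    have "(f ^^ n) (y 0 + r / 2) = t" "(f ^^ n) (y 0) = y n"
      using iterate_P J_subset_B[OF s_in] t iterate_y[of n 0] by auto
    then have "t \<in> (f ^^ n) ` ball (y 0) r" "y n \<in> (f ^^ n) ` ball (y 0) r"
      using \<open>y 0 + r / 2 \<in> ball (y 0) r\<close> r by (metis imageI, metis imageI centre_in_ball)
    moreover have "bounded ((f ^^ n) ` ball (y 0) r)"
      using fimg J_eq[OF s_in] by (metis bounded_closed_interval bounded_subset cbox_interval bounded_cbox)
    ultimately show ?thesis using diameter_bounded_bound by (fastforce simp: dist_real_def)
  qed
  moreover have "\<delta> / (4 * K\<^sup>2) < \<delta> / (2 * K\<^sup>2)"
    using \<delta> K by (simp add: field_simps)
  ultimately show "diameter ((f ^^ n) ` ball (y 0) r) > \<delta> / (4 * K\<^sup>2)" by simp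
  have "\<bar>deriv (f ^^ n) z1\<bar> / \<bar>deriv (f ^^ n) z2\<bar> \<le> K" if z: "z1 \<in> ball (y 0) r" "z2 \<in> ball (y 0) r" for z1 z2
  proof -
    obtain t1 t2 where t: "lo (s n) < t1" "t1 < hi (s n)" "t1 \<in> J (s n)" "z1 = P 0 n t1"
        "lo (s n) < t2" "t2 < hi (s n)" "t2 \<in> J (s n)" "z2 = P 0 n t2"
      using ball_pt z by metis
    have "deriv (f ^^ n) z1 = inverse (Gd (map s [0..<n]) t1)"
      "deriv (f ^^ n) z2 = inverse (Gd (map s [0..<n]) t2)"
      using iterate_deriv_P t DERIV_imp_deriv by blast+
    moreover have "Gd (map s [0..<n]) t1 \<noteq> 0" 
      using Gd_nonzero[OF s_word] t(3) J_subset_B[OF s_in] by blast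
    then have "\<bar>Gd (map s [0..<n]) t2\<bar> / \<bar>Gd (map s [0..<n]) t1\<bar> \<le> K"
      using dist[OF t(7,3)] by (simp add: divide_le_eq mult.commute)
    ultimately show ?thesis by (simp add: divide_inverse mult.commute)
  qed
  then have "Dist (f ^^ n) (ball (y 0) r) \<le> ereal K"
    unfolding Dist_def by (intro SUP_least) auto
  also have "ereal K < ereal (K\<^sup>2 + 1)"
  proof -
    have "(K - 1)\<^sup>2 \<ge> 0" by simp
    then have "2 * K \<le> K\<^sup>2 + 1" by (simp add: power2_eq_square algebra_simps)
    then show ?thesis using K by simp
  qed
  finally show "Dist (f ^^ n) (ball (y 0) r) < ereal (K\<^sup>2 + 1)" .
qed

text \<open>\<open>hyperbolic_time\<close> yields the same constants for all times in
  \<open>M\<close>; what remains is to make the radii decrease to 0.\<close>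

lemma in_H_set:
  assumes M: "infinite M"
    and C: "\<And>n t1 t2. n \<in> M \<Longrightarrow> t1 \<in> J (s n) \<Longrightarrow> t2 \<in> J (s n) \<Longrightarrow> (\<Sum>k\<in>{..n}. \<bar>P k n t1 - P k n t2\<bar>) \<le> C"
    and x: "y 0 \<in> Lambda_Q p J g Q"
  shows "y 0 \<in> H_set p J g Q"
proof -
  obtain L where L: "distortion_const L" using distortion_const_exists by blast
  obtain \<delta> where \<delta>: "\<delta> > 0" "\<And>i t. i \<in> {1..p} \<Longrightarrow> t \<in> B \<Longrightarrow> lo i + \<delta> \<le> g i t \<and> g i t \<le> hi i - \<delta>"
    by (rule g_margin) blast
  have margin: "lo (s n) + \<delta> \<le> y n" "y n \<le> hi (s n) - \<delta>" for n
    using \<delta>(2)[OF s_in y_B] y_step[of n] by metis+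
  define K where "K = exp (L * C)"
  define r where "r n = \<delta> * \<bar>Gd (map s [0..<n]) (y n)\<bar> / K" for n
  note time = hyperbolic_time[OF L \<delta>(1) margin C, folded K_def, folded r_def]
  have K: "K > 0" by (simp add: K_def)
  have r: "r n > 0" for n using \<delta>(1) K Gd_y_pos[of 0 n] by (simp add: r_def)
  define e where "e = enumerate M"
  have e: "strict_mono e" "\<And>k. e k \<in> M"
    using M strict_mono_enumerate enumerate_in_set by (auto simp: e_def)
  \<comment> \<open>The ball belonging to the time \<open>e k\<close> lies in a cylinder of length
    \<open>e k + 1\<close>, and these shrink.\<close>
  have lim: "(\<lambda>k. r (e k)) \<longlonglongrightarrow> 0"
  proof (rule LIMSEQ_I)
    fix \<epsilon> :: real assume "\<epsilon> > 0"
    then have "\<epsilon> / 2 > 0" by simp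
    then obtain N where N: "\<And>w t1 t2. set w \<subseteq> {1..p} \<Longrightarrow> length w \<ge> N \<Longrightarrow> t1 \<in> cyl w \<Longrightarrow> t2 \<in> cyl w \<Longrightarrow> \<bar>t1 - t2\<bar> < \<epsilon> / 2"
      by (rule cyl_small) blast
    show "\<exists>k0. \<forall>k\<ge>k0. norm (r (e k) - 0) < \<epsilon>"
    proof (intro exI[of _ N] allI impI)
      fix k assume "N \<le> k"
      then have Nk: "N \<le> e k" using seq_suble[OF e(1), of k] by simp
      let ?w = "map s [0..<e k] @ [s (e k)]"
      have "ball (y 0) (r (e k)) \<subseteq> cyl ?w"
        unfolding cyl_P using time(1)[OF e(2)] J_eq[OF s_in] by fastforce
      moreover have "y 0 \<in> ball (y 0) (r (e k))" "y 0 + r (e k) / 2 \<in> ball (y 0) (r (e k))"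
        using r[of "e k"] by (auto simp: dist_real_def)
      moreover have "set ?w \<subseteq> {1..p}" "length ?w \<ge> N" using s_word[of "[0..<e k]"] s_in Nk by auto
      ultimately have "\<bar>y 0 - (y 0 + r (e k) / 2)\<bar> < \<epsilon> / 2" using N by blast
      then show "norm (r (e k) - 0) < \<epsilon>" using r[of "e k"] by simp
    qed
  qed
  \<comment> \<open>A monotone subsequence of positive radii tending to 0 is decreasing, as the
    definition of H demands.\<close>
  obtain \<phi> where \<phi>: "strict_mono \<phi>" "monoseq (\<lambda>k. r (e (\<phi> k)))"
    using seq_monosub[of "\<lambda>k. r (e k)"] by blast
  have lim': "(\<lambda>k. r (e (\<phi> k))) \<longlonglongrightarrow> 0"
    using LIMSEQ_subseq_LIMSEQ[OF lim \<phi>(1)] by (simp add: comp_def)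
  have dec: "decseq (\<lambda>k. r (e (\<phi> k)))"
  proof -
    have "\<not> (\<forall>k. r (e (\<phi> k)) \<le> 0)" using r by (auto simp: not_le)
    then show ?thesis using monoseq_le[OF \<phi>(2) lim'] unfolding decseq_def by blast
  qed
  define n where "n k = e (\<phi> k)" for k
  have "strict_mono n" using e(1) \<phi>(1) by (auto simp: strict_mono_def n_def)
  moreover have nM: "n k \<in> M" for k using e(2) by (simp add: n_def)
  ultimately have "strict_mono n \<and> (\<forall>k. r (n k) > 0) \<and> decseq (\<lambda>k. r (n k)) \<and> (\<lambda>k. r (n k)) \<longlonglongrightarrow> 0 \<and>
       (\<forall>k. iterate_defined_on p J g (n k) (ball (y 0) (r (n k))) \<and>
            diameter ((f ^^ n k) ` ball (y 0) (r (n k))) > \<delta> / (4 * K\<^sup>2) \<and>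
            Dist (f ^^ n k) (ball (y 0) (r (n k))) < ereal (K\<^sup>2 + 1))"
    using time(2,3,4)[OF nM] r dec[folded n_def] lim'[folded n_def] by blast
  then have "\<exists>(n :: nat \<Rightarrow> nat) (r :: nat \<Rightarrow> real). strict_mono n \<and> (\<forall>k. r k > 0) \<and> decseq r \<and> r \<longlonglongrightarrow> 0 \<and>
       (\<forall>k. iterate_defined_on p J g (n k) (ball (y 0) (r k)) \<and>
            diameter ((f ^^ n k) ` ball (y 0) (r k)) > \<delta> / (4 * K\<^sup>2) \<and>
            Dist (f ^^ n k) (ball (y 0) (r k)) < ereal (K\<^sup>2 + 1))" (is "?H (\<delta> / (4 * K\<^sup>2)) (K\<^sup>2 + 1)")
    by (intro exI[of _ n] exI[of _ "\<lambda>k. r (n k)"])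
  moreover have "\<delta> / (4 * K\<^sup>2) > 0" using \<delta>(1) K by simp
  moreover have "K\<^sup>2 + 1 > 0" using zero_le_power2[of K] by linarith
  ultimately have "\<exists>c1>0. \<exists>c2>0. ?H c1 c2" by blast
  then show ?thesis unfolding H_set_def using x by simp
qed

text \<open>If pulling back from one element of \<open>M\<close> to the preceding one contracts by a uniform factor, the
  pullback lengths of the separate blocks add up to a geometric series.\<close>

lemma in_H_set_if_contracting:
  assumes M: "infinite M" and w: "w \<noteq> []" and occ: "\<And>n. n \<in> M \<Longrightarrow> map s [n..<n + length w] = w"
    and \<rho>: "0 \<le> \<rho>" "\<rho> < 1" and b: "b \<ge> 0"
    and sum: "\<And>n' n t1 t2. n' \<in> M \<Longrightarrow> n \<in> M \<Longrightarrow> n' < n \<Longrightarrow> (\<And>m. m \<in> M \<Longrightarrow> m \<le> n' \<or> n \<le> m) \<Longrightarrow>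
      t1 \<in> cyl w \<Longrightarrow> t2 \<in> cyl w \<Longrightarrow> (\<Sum>k\<in>{n'..<n}. \<bar>P k n t1 - P k n t2\<bar>) \<le> b * \<bar>t1 - t2\<bar>"
    and contr: "\<And>n' n t1 t2. n' \<in> M \<Longrightarrow> n \<in> M \<Longrightarrow> n' < n \<Longrightarrow> (\<And>m. m \<in> M \<Longrightarrow> m \<le> n' \<or> n \<le> m) \<Longrightarrow>
      t1 \<in> cyl w \<Longrightarrow> t2 \<in> cyl w \<Longrightarrow> \<bar>P n' n t1 - P n' n t2\<bar> \<le> \<rho> * \<bar>t1 - t2\<bar>"
    and x: "y 0 \<in> Lambda_Q p J g Q"
  shows "y 0 \<in> H_set p J g Q"
proof -
  define n0 where "n0 = (LEAST n. n \<in> M)"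
  have n0: "n0 \<in> M" "\<And>n. n \<in> M \<Longrightarrow> n0 \<le> n"
    unfolding n0_def using M by (auto intro: LeastI_ex Least_le simp: infinite_imp_nonempty ex_in_conv)
  have into: "P n' n ` cyl w \<subseteq> cyl w" if "n' \<in> M" "n \<in> M" "n' \<le> n" for n' n
  proof -
    have "P n' n ` cyl w = cyl (map s [n'..<n + length w])"
      using P_image_cyl[OF that(3), of "length w"] occ[OF that(2)] w by simp
    also have "\<dots> \<subseteq> cyl (map s [n'..<n' + length w])"
      using cyl_decreasing[of "length w" "n - n' + length w" n'] w that(3) by simp
    finally show ?thesis using occ[OF that(1)] by simp
  qed
  \<comment> \<open>The factor solves \<open>c = b + \<rho> * c\<close>: the newest block
    contributes \<open>b\<close>, and all earlier blocks see the contracted pair.\<close>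
  have main: "n \<in> M \<Longrightarrow> t1 \<in> cyl w \<Longrightarrow> t2 \<in> cyl w \<Longrightarrow>
      (\<Sum>k\<in>{n0..<n}. \<bar>P k n t1 - P k n t2\<bar>) \<le> b / (1 - \<rho>) * \<bar>t1 - t2\<bar>" for n t1 t2
  proof (induction n arbitrary: t1 t2 rule: less_induct)
    case (less n)
    show ?case
    proof (cases "n = n0")
      case True
      then show ?thesis using b \<rho> by simp
    next
      case False
      let ?S = "{m \<in> M. m < n}"
      have S: "finite ?S" "n0 \<in> ?S" using n0 less.prems(1) False by (auto simp: le_neq_implies_less)
      define n' where "n' = Max ?S"
      have "n' \<in> ?S" unfolding n'_def using S by (intro Max_in) auto
      then have n': "n' \<in> M" "n' < n" "n0 \<le> n'" using n0 by auto
      have cons: "m \<le> n' \<or> n \<le> m" if "m \<in> M" for m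
        using Max_ge[OF S(1), of m] that by (auto simp: n'_def not_le)
      have "{n0..<n} = {n0..<n'} \<union> {n'..<n}" using n' by auto
      then have split: "(\<Sum>k\<in>{n0..<n}. \<bar>P k n t1 - P k n t2\<bar>) =
          (\<Sum>k\<in>{n0..<n'}. \<bar>P k n t1 - P k n t2\<bar>) + (\<Sum>k\<in>{n'..<n}. \<bar>P k n t1 - P k n t2\<bar>)"
        by (simp add: sum.union_disjoint)
      have c: "P n' n t1 \<in> cyl w" "P n' n t2 \<in> cyl w"
        using into[OF n'(1) less.prems(1) less_imp_le[OF n'(2)]] less.prems(2,3) by blast+
      have "(\<Sum>k\<in>{n0..<n'}. \<bar>P k n t1 - P k n t2\<bar>) =
          (\<Sum>k\<in>{n0..<n'}. \<bar>P k n' (P n' n t1) - P k n' (P n' n t2)\<bar>)"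
      proof (intro sum.cong refl)
        fix k assume "k \<in> {n0..<n'}"
        then show "\<bar>P k n t1 - P k n t2\<bar> = \<bar>P k n' (P n' n t1) - P k n' (P n' n t2)\<bar>"
          using n'(2) P_comp[of k n' n] by simp
      qed
      also have "\<dots> \<le> b / (1 - \<rho>) * \<bar>P n' n t1 - P n' n t2\<bar>"
        by (rule less.IH[OF n'(2,1) c])
      also have "\<dots> \<le> b / (1 - \<rho>) * (\<rho> * \<bar>t1 - t2\<bar>)"
        using contr[OF n'(1) less.prems(1) n'(2) cons less.prems(2,3)] b \<rho> by (intro mult_left_mono) auto
      finally have old: "(\<Sum>k\<in>{n0..<n'}. \<bar>P k n t1 - P k n t2\<bar>) \<le> b / (1 - \<rho>) * (\<rho> * \<bar>t1 - t2\<bar>)" .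
      have new: "(\<Sum>k\<in>{n'..<n}. \<bar>P k n t1 - P k n t2\<bar>) \<le> b * \<bar>t1 - t2\<bar>"
        by (rule sum[OF n'(1) less.prems(1) n'(2) cons less.prems(2,3)])
      have "b / (1 - \<rho>) * (\<rho> * \<bar>t1 - t2\<bar>) + b * \<bar>t1 - t2\<bar> = b / (1 - \<rho>) * \<bar>t1 - t2\<bar>"
        using \<rho> by (simp add: field_simps)
      then show ?thesis using split old new by linarith
    qed
  qed
  define l where "l = length w - 1"
  have l: "length w = Suc l" using w by (cases w) (auto simp: l_def)
  \<comment> \<open>The criterion concerns pullbacks of a whole interval \<open>J (s n)\<close>. At
    the last letter of an occurrence of \<open>w\<close>, the pullback of that interval to the first
    letter is exactly \<open>cyl w\<close>; hence the shift by \<open>l\<close>.\<close>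
  show ?thesis
  proof (rule in_H_set[OF _ _ x])
    show "infinite ((\<lambda>n. n + l) ` M)" using M by (simp add: finite_image_iff inj_on_def)
    fix n t1 t2 assume "n \<in> (\<lambda>n. n + l) ` M" and t: "t1 \<in> J (s n)" "t2 \<in> J (s n)"
    then obtain m where m: "m \<in> M" "n = m + l" by auto
    have tB: "t1 \<in> B" "t2 \<in> B" using t J_subset_B[OF s_in] by auto
    have "cyl w = P m n ` J (s n)"
      using occ[OF m(1)] l cyl_P[of m n] m(2) by simp
    then have c: "P m n t1 \<in> cyl w" "P m n t2 \<in> cyl w" using t by auto
    \<comment> \<open>The transient before \<open>n0\<close> and the stretch inside \<open>w\<close>
      have a fixed number of terms; the stretch between them is covered by
      \<open>main\<close>.\<close>
    have "{..n} = {..<n0} \<union> ({n0..<m} \<union> {m..n})" using m(2) n0(2)[OF m(1)] by auto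
    moreover have "{n0..<m} \<inter> {m..n} = {}" "{..<n0} \<inter> ({n0..<m} \<union> {m..n}) = {}"
      using n0(2)[OF m(1)] by auto
    ultimately have split: "(\<Sum>k\<in>{..n}. \<bar>P k n t1 - P k n t2\<bar>) = (\<Sum>k\<in>{..<n0}. \<bar>P k n t1 - P k n t2\<bar>) +
        ((\<Sum>k\<in>{n0..<m}. \<bar>P k n t1 - P k n t2\<bar>) + (\<Sum>k\<in>{m..n}. \<bar>P k n t1 - P k n t2\<bar>))"
      by (simp add: sum.union_disjoint)
    have "(\<Sum>k\<in>{n0..<m}. \<bar>P k n t1 - P k n t2\<bar>) =
        (\<Sum>k\<in>{n0..<m}. \<bar>P k m (P m n t1) - P k m (P m n t2)\<bar>)"
    proof (intro sum.cong refl)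
      fix k assume "k \<in> {n0..<m}"
      then show "\<bar>P k n t1 - P k n t2\<bar> = \<bar>P k m (P m n t1) - P k m (P m n t2)\<bar>"
        using m(2) P_comp[of k m n] by simp
    qed
    also have "\<dots> \<le> b / (1 - \<rho>) * \<bar>P m n t1 - P m n t2\<bar>" by (rule main[OF m(1) c])
    also have "\<dots> \<le> b / (1 - \<rho>) * len" 
      using P_diff_le_len[OF tB] b \<rho> by (intro mult_left_mono) auto
    finally have middle: "(\<Sum>k\<in>{n0..<m}. \<bar>P k n t1 - P k n t2\<bar>) \<le> b / (1 - \<rho>) * len" .
    have "(\<Sum>k\<in>{..<n0}. \<bar>P k n t1 - P k n t2\<bar>) \<le> n0 * len"
      using P_sum_le_len[OF tB, where F = "{..<n0}"] by simp
    moreover have "(\<Sum>k\<in>{m..n}. \<bar>P k n t1 - P k n t2\<bar>) \<le> Suc l * len"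
      using P_sum_le_len[OF tB, where F = "{m..n}"] m(2) by simp
    ultimately show "(\<Sum>k\<in>{..n}. \<bar>P k n t1 - P k n t2\<bar>) \<le> n0 * len + (b / (1 - \<rho>) * len + Suc l * len)"
      using split middle by linarith
  qed
qed

section \<open>Disjoint pullbacks and long gaps\<close>

lemma P_segment:
  assumes "\<alpha> \<le> \<beta>" "{\<alpha>..\<beta>} \<subseteq> J (s n)"
  shows "P k n ` {\<alpha>..\<beta>} = closed_segment (P k n \<alpha>) (P k n \<beta>)"
proof -
  have "\<alpha> \<in> J (s n)" "\<beta> \<in> J (s n)" using assms by auto
  then have "P k n ` closed_segment \<alpha> \<beta> = closed_segment (P k n \<alpha>) (P k n \<beta>)"
    unfolding P_def by (rule G_segment[OF s_word s_in])
  then show ?thesis using assms(1) by (simp add: closed_segment_eq_real_ivl)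
qed

lemma P_diff_mono:
  assumes "{\<alpha>..\<beta>} \<subseteq> J (s n)" "t1 \<in> {\<alpha>..\<beta>}" "t2 \<in> {\<alpha>..\<beta>}"
  shows "\<bar>P k n t1 - P k n t2\<bar> \<le> \<bar>P k n \<alpha> - P k n \<beta>\<bar>"
proof -
  have "\<alpha> \<le> \<beta>" using assms(2) by auto
  then have "P k n t1 \<in> closed_segment (P k n \<alpha>) (P k n \<beta>)" "P k n t2 \<in> closed_segment (P k n \<alpha>) (P k n \<beta>)"
    using P_segment[OF _ assms(1)] assms(2,3) by blast+
  then show ?thesis by (auto simp: closed_segment_eq_real_ivl split: if_splits)
qed

text \<open>A bound \<open>C\<close> on the total pullback length of
  \<open>{\<alpha>..\<beta>}\<close> bounds the distortion on it, so a pair of its points keeps its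
  relative distance up to a constant factor.\<close>

lemma P_diff_proportional:
  assumes L: "distortion_const L" and \<alpha>\<beta>: "\<alpha> < \<beta>" "{\<alpha>..\<beta>} \<subseteq> J (s n)"
    and C: "(\<Sum>k\<in>{n'..<n}. \<bar>P k n \<alpha> - P k n \<beta>\<bar>) \<le> C"
    and t: "t1 \<in> {\<alpha>..\<beta>}" "t2 \<in> {\<alpha>..\<beta>}" and j: "n' \<le> j" "j < n"
  shows "\<bar>P j n t1 - P j n t2\<bar> \<le> exp (L * (C + len)) * \<bar>P j n \<alpha> - P j n \<beta>\<bar> / (\<beta> - \<alpha>) * \<bar>t1 - t2\<bar>"
proof -
  let ?K = "exp (L * (C + len))"
  have JB: "J (s n) \<subseteq> B" using J_subset_B[OF s_in] .
  have dist: "\<bar>Gd (map s [j..<n]) u1\<bar> \<le> \<bar>Gd (map s [j..<n]) u2\<bar> * ?K"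
    if u: "u1 \<in> {\<alpha>..\<beta>}" "u2 \<in> {\<alpha>..\<beta>}" for u1 u2
  proof -
    have uB: "u1 \<in> B" "u2 \<in> B" using u \<alpha>\<beta> JB by blast+
    have "orbit_dist (map s [j..<n]) u1 u2 = (\<Sum>k\<in>{Suc j..n}. \<bar>P k n u1 - P k n u2\<bar>)"
      using orbit_dist_sum j by simp
    \<comment> \<open>The term at time \<open>n\<close> is not covered by \<open>C\<close>; it
      accounts for the summand \<open>len\<close> in the exponent.\<close>
    also have "{Suc j..n} = insert n {Suc j..<n}" using j by auto
    also have "(\<Sum>k\<in>insert n {Suc j..<n}. \<bar>P k n u1 - P k n u2\<bar>) =
        \<bar>u1 - u2\<bar> + (\<Sum>k\<in>{Suc j..<n}. \<bar>P k n u1 - P k n u2\<bar>)" by simp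
    finally have eq: "orbit_dist (map s [j..<n]) u1 u2 =
        \<bar>u1 - u2\<bar> + (\<Sum>k\<in>{Suc j..<n}. \<bar>P k n u1 - P k n u2\<bar>)" .
    have "(\<Sum>k\<in>{Suc j..<n}. \<bar>P k n u1 - P k n u2\<bar>) \<le> (\<Sum>k\<in>{Suc j..<n}. \<bar>P k n \<alpha> - P k n \<beta>\<bar>)"
      by (intro sum_mono P_diff_mono[OF \<alpha>\<beta>(2) u])
    also have "\<dots> \<le> (\<Sum>k\<in>{n'..<n}. \<bar>P k n \<alpha> - P k n \<beta>\<bar>)"
      using j by (intro sum_mono2) auto
    finally have "orbit_dist (map s [j..<n]) u1 u2 \<le> C + len"
      using eq C abs_diff_le_len[OF uB] by linarith
    then have "exp (L * orbit_dist (map s [j..<n]) u1 u2) \<le> ?K"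
      using L unfolding distortion_const_def by (auto intro: mult_left_mono)
    then show ?thesis
      using distortion[OF L s_word uB, of "[j..<n]"] by (meson abs_ge_zero mult_left_mono order_trans)
  qed
  have tJ: "t1 \<in> J (s n)" "t2 \<in> J (s n)" "\<alpha> \<in> J (s n)" "\<beta> \<in> J (s n)" using t \<alpha>\<beta> by auto
  obtain \<xi> where \<xi>: "\<xi> \<in> closed_segment t1 t2" "\<bar>P j n t1 - P j n t2\<bar> = \<bar>Gd (map s [j..<n]) \<xi>\<bar> * \<bar>t1 - t2\<bar>"
    unfolding P_def using G_MVT[OF s_word s_in tJ(1,2)] by blast
  obtain \<eta> where \<eta>: "\<eta> \<in> closed_segment \<alpha> \<beta>" "\<bar>P j n \<alpha> - P j n \<beta>\<bar> = \<bar>Gd (map s [j..<n]) \<eta>\<bar> * \<bar>\<alpha> - \<beta>\<bar>"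
    unfolding P_def using G_MVT[OF s_word s_in tJ(3,4)] by blast
  have in\<alpha>\<beta>: "\<xi> \<in> {\<alpha>..\<beta>}" "\<eta> \<in> {\<alpha>..\<beta>}"
    using \<xi>(1) \<eta>(1) t \<alpha>\<beta>(1) by (auto simp: closed_segment_eq_real_ivl split: if_splits)
  have "\<bar>P j n t1 - P j n t2\<bar> \<le> \<bar>Gd (map s [j..<n]) \<eta>\<bar> * ?K * \<bar>t1 - t2\<bar>"
    unfolding \<xi>(2) by (intro mult_right_mono dist in\<alpha>\<beta>) simp
  also have "\<bar>Gd (map s [j..<n]) \<eta>\<bar> = \<bar>P j n \<alpha> - P j n \<beta>\<bar> / (\<beta> - \<alpha>)"
    using \<eta>(2) \<alpha>\<beta>(1) by (simp add: field_simps)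
  finally show ?thesis by (simp add: mult_ac)
qed

text \<open>The distortion on \<open>{\<alpha>..\<beta>}\<close> is bounded independently of the gap length, so gaps so long that all
  cylinders of that depth are tiny compared with \<open>\<beta> - \<alpha>\<close> force a contraction by \<open>1/2\<close>.\<close>

lemma in_H_set_if_gaps:
  assumes M: "infinite M" and w: "w \<noteq> []" and occ: "\<And>n. n \<in> M \<Longrightarrow> map s [n..<n + length w] = w"
    and L: "distortion_const L" and \<alpha>\<beta>: "\<alpha> < \<beta>" "cyl w \<subseteq> {\<alpha>..\<beta>}" "{\<alpha>..\<beta>} \<subseteq> J (hd w)"
    and small: "\<And>v t1 t2. set v \<subseteq> {1..p} \<Longrightarrow> length v \<ge> N \<Longrightarrow> t1 \<in> cyl v \<Longrightarrow> t2 \<in> cyl v \<Longrightarrow>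
      \<bar>t1 - t2\<bar> < (\<beta> - \<alpha>) / (2 * exp (L * (C + len)))"
    and gap: "\<And>n' n. n' \<in> M \<Longrightarrow> n \<in> M \<Longrightarrow> n' < n \<Longrightarrow> n' + N \<le> n"
    and sum: "\<And>n' n. n' \<in> M \<Longrightarrow> n \<in> M \<Longrightarrow> n' < n \<Longrightarrow> (\<And>m. m \<in> M \<Longrightarrow> m \<le> n' \<or> n \<le> m) \<Longrightarrow>
      (\<Sum>k\<in>{n'..<n}. \<bar>P k n \<alpha> - P k n \<beta>\<bar>) \<le> C"
    and C: "C \<ge> 0" and x: "y 0 \<in> Lambda_Q p J g Q"
  shows "y 0 \<in> H_set p J g Q"
proof -
  let ?K = "exp (L * (C + len))"
  have sn: "s n = hd w" if "n \<in> M" for n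
  proof -
    have "map s [n..<n + length w] = s n # map s [Suc n..<n + length w]"
      using w by (intro map_upt_Cons) auto
    then show ?thesis using occ[OF that] by (metis list.sel(1))
  qed
  show ?thesis
  proof (rule in_H_set_if_contracting[where M = M and w = w and \<rho> = "1/2" and b = "?K * C / (\<beta> - \<alpha>)"])
    show "0 \<le> ?K * C / (\<beta> - \<alpha>)" using C \<alpha>\<beta>(1) by simp
  next
    fix n' n t1 t2
    assume n: "n' \<in> M" "n \<in> M" "n' < n" and cons: "\<And>m. m \<in> M \<Longrightarrow> m \<le> n' \<or> n \<le> m"
      and t: "t1 \<in> cyl w" "t2 \<in> cyl w"
    have J: "{\<alpha>..\<beta>} \<subseteq> J (s n)" using \<alpha>\<beta>(3) sn[OF n(2)] by simp
    have t': "t1 \<in> {\<alpha>..\<beta>}" "t2 \<in> {\<alpha>..\<beta>}" using t \<alpha>\<beta>(2) by auto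
    note C' = sum[OF n cons]
    note pd = P_diff_proportional[OF L \<alpha>\<beta>(1) J C' t']
    have "(\<Sum>k\<in>{n'..<n}. \<bar>P k n t1 - P k n t2\<bar>) \<le>
        (\<Sum>k\<in>{n'..<n}. (?K / (\<beta> - \<alpha>) * \<bar>t1 - t2\<bar>) * \<bar>P k n \<alpha> - P k n \<beta>\<bar>)"
      using pd by (intro sum_mono) (simp add: mult_ac)
    also have "\<dots> = (?K / (\<beta> - \<alpha>) * \<bar>t1 - t2\<bar>) * (\<Sum>k\<in>{n'..<n}. \<bar>P k n \<alpha> - P k n \<beta>\<bar>)"
      by (simp add: sum_distrib_left)
    also have "\<dots> \<le> (?K / (\<beta> - \<alpha>) * \<bar>t1 - t2\<bar>) * C"
      using C' \<alpha>\<beta>(1) by (intro mult_left_mono) auto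
    finally show "(\<Sum>k\<in>{n'..<n}. \<bar>P k n t1 - P k n t2\<bar>) \<le> ?K * C / (\<beta> - \<alpha>) * \<bar>t1 - t2\<bar>"
      by (simp add: mult_ac)
    let ?v = "map s [n'..<n] @ [s n]"
    have "\<alpha> \<in> J (s n)" "\<beta> \<in> J (s n)" using J \<alpha>\<beta>(1) by auto
    then have "P n' n \<alpha> \<in> cyl ?v" "P n' n \<beta> \<in> cyl ?v" unfolding cyl_P by blast+
    moreover have "set ?v \<subseteq> {1..p}" "length ?v \<ge> N"
      using s_word[of "[n'..<n]"] s_in[of n] gap[OF n] by auto
    ultimately have sm: "\<bar>P n' n \<alpha> - P n' n \<beta>\<bar> < (\<beta> - \<alpha>) / (2 * ?K)" using small by blast
    have "?K * \<bar>P n' n \<alpha> - P n' n \<beta>\<bar> / (\<beta> - \<alpha>) \<le> 1/2"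
      using sm \<alpha>\<beta>(1) by (simp add: field_simps)
    then have "?K * \<bar>P n' n \<alpha> - P n' n \<beta>\<bar> / (\<beta> - \<alpha>) * \<bar>t1 - t2\<bar> \<le> 1/2 * \<bar>t1 - t2\<bar>"
      by (intro mult_right_mono) auto
    then show "\<bar>P n' n t1 - P n' n t2\<bar> \<le> 1/2 * \<bar>t1 - t2\<bar>"
      using pd[of n'] n(3) by linarith
  qed (use M w occ x in auto)
qed

lemma disjoint_pullbacks_sum:
  assumes "finite F" "\<alpha> < \<beta>" "{\<alpha>..\<beta>} \<subseteq> J (s n)"
    and disj: "\<And>i j. i \<in> F \<Longrightarrow> j \<in> F \<Longrightarrow> i < j \<Longrightarrow> P i n ` {\<alpha>..\<beta>} \<inter> P j n ` {\<alpha>..\<beta>} = {}"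
  shows "(\<Sum>k\<in>F. \<bar>P k n \<alpha> - P k n \<beta>\<bar>) \<le> len"
proof -
  obtain a where a: "I = {a..a + len}" by (rule I_interval)
  have seg: "closed_segment (P k n \<alpha>) (P k n \<beta>) = P k n ` {\<alpha>..\<beta>}" for k
    using P_segment[OF _ assms(3)] assms(2) by simp
  have "(\<Sum>k\<in>F. \<bar>P k n \<alpha> - P k n \<beta>\<bar>) \<le> (a + len) - a"
  proof (rule disjoint_segments_length[OF assms(1)])
    show "a \<le> a + len" using len_nonneg by simp
    fix k
    have "\<alpha> \<in> {\<alpha>..\<beta>}" "\<beta> \<in> {\<alpha>..\<beta>}" using assms(2) by auto
    then have "\<alpha> \<in> B" "\<beta> \<in> B" using assms(3) J_subset_B[OF s_in, of n] by blast+
    then show "P k n \<alpha> \<in> {a..a + len} \<and> P k n \<beta> \<in> {a..a + len}"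
      using P_in_B B_subset_I a by blast
  next
    fix i j assume "i \<in> F" "j \<in> F" "i \<noteq> j"
    then show "closed_segment (P i n \<alpha>) (P i n \<beta>) \<inter> closed_segment (P j n \<alpha>) (P j n \<beta>) = {}"
      unfolding seg using disj[of i j] disj[of j i] by (cases "i < j") auto
  qed
  then show ?thesis by simp
qed

text \<open>Both pullbacks are cylinders of words ending at the same time \<open>n + l\<close>. If
  they meet, the shorter word is a prefix of the longer one, so the coding repeats itself after
  \<open>j - i\<close> steps.\<close>

lemma overlap_imp_repetition:
  assumes ij: "i < j" "j \<le> n" and l: "l > 0"
    and t: "t \<in> P i n ` cyl (map s [n..<n + l])" "t \<in> P j n ` cyl (map s [n..<n + l])" and k: "k < n + l - j"
  shows "s (i + k) = s (j + k)"
proof -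
  let ?u = "map s [j..<n + l]" and ?v = "map s [i..<n + l]"
  have "t \<in> cyl ?u" "t \<in> cyl ?v"
    using t P_image_cyl[OF _ l, of i n] P_image_cyl[OF _ l, of j n] ij by auto
  moreover have "?u \<noteq> []" "length ?u \<le> length ?v" using ij l by auto
  ultimately have "?u = take (length ?u) ?v"
    using cyl_meet_prefix[of ?u ?v] s_word by blast
  then have "?u ! k = take (length ?u) ?v ! k" by (rule arg_cong)
  also have "\<dots> = ?v ! k" using k by (intro nth_take) simp
  finally show ?thesis using k ij by simp
qed

lemma occ_nth: "map s [n..<n + length w] = w \<longleftrightarrow> (\<forall>k<length w. s (n + k) = w ! k)"
  unfolding list_eq_iff_nth_eq[of _ w] by simp

text \<open>Made for periodic \<open>\<zeta>\<close>. The times used are the occurrences of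
  \<open>c\<close> that no other occurrence precedes by fewer than \<open>N\<close> steps. They are
  \<open>N\<close> apart, although further occurrences may lie between them.\<close>

lemma in_H_set_if_unbounded_gaps:
  assumes c: "c \<noteq> []" and R: "R = {n. map s [n..<n + length c] = c}"
    and unb: "\<And>N. infinite {n \<in> R. \<forall>m\<in>R. m < n \<longrightarrow> m + N \<le> n}"
    and x: "y 0 \<in> Lambda_Q p J g Q"
  shows "y 0 \<in> H_set p J g Q"
proof -
  obtain L where L: "distortion_const L" using distortion_const_exists by blast
  let ?l = "length c"
  have l: "?l > 0" using c by simp
  obtain n1 where "n1 \<in> R" using unb[of 0] not_finite_existsD by blast
  then have cw: "set c \<subseteq> {1..p}" using s_word[of "[n1..<n1 + ?l]"] R by auto
  obtain \<alpha> \<beta> where \<alpha>\<beta>: "\<alpha> < \<beta>" "cyl c = {\<alpha>..\<beta>}" using cyl_interval[OF cw c] by blast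
  \<comment> \<open>\<open>C\<close> is fixed before \<open>N\<close>, which depends on it. Its
    value anticipates two families of disjoint pullbacks, each of total length at most
    \<open>len\<close>.\<close>
  define C where "C = 2 * len"
  have C: "C \<ge> 0" using len_nonneg by (simp add: C_def)
  have "(\<beta> - \<alpha>) / (2 * exp (L * (C + len))) > 0" using \<alpha>\<beta>(1) by simp
  then obtain N where N: "\<And>v t1 t2. set v \<subseteq> {1..p} \<Longrightarrow> length v \<ge> N \<Longrightarrow> t1 \<in> cyl v \<Longrightarrow> t2 \<in> cyl v \<Longrightarrow>
      \<bar>t1 - t2\<bar> < (\<beta> - \<alpha>) / (2 * exp (L * (C + len)))" by (rule cyl_small) blast
  define M where "M = {n \<in> R. \<forall>m\<in>R. m < n \<longrightarrow> m + N \<le> n}"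
  have occ: "map s [n..<n + ?l] = c" if "n \<in> M" for n using that by (simp add: M_def R)
  show ?thesis
  proof (rule in_H_set_if_gaps[OF _ c occ L \<alpha>\<beta>(1) _ _ N _ _ C x])
    show "infinite M" unfolding M_def by (rule unb)
    show "cyl c \<subseteq> {\<alpha>..\<beta>}" using \<alpha>\<beta> by simp
    show "{\<alpha>..\<beta>} \<subseteq> J (hd c)" using cyl_J_hd[OF cw c] \<alpha>\<beta> by simp
    show "n' + N \<le> n" if "n' \<in> M" "n \<in> M" "n' < n" for n' n using that by (auto simp: M_def)
  next
    fix n' n
    assume n: "n' \<in> M" "n \<in> M" "n' < n" and cons: "\<And>m. m \<in> M \<Longrightarrow> m \<le> n' \<or> n \<le> m"
    have sn: "map s [n..<n + ?l] = c" by (rule occ[OF n(2)])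
    have J: "{\<alpha>..\<beta>} \<subseteq> J (s n)"
    proof -
      have "y n \<in> cyl c" using y_cyl[OF l, of n] sn by simp
      then have "y n \<in> J (hd c)" using cyl_J_hd[OF cw c] by blast
      moreover have "hd c \<in> {1..p}" using hd_in_alphabet[OF cw c] .
      ultimately have "hd c = s n" using J_disjoint s_in y_J by blast
      then show ?thesis using cyl_J_hd[OF cw c] \<alpha>\<beta> by simp
    qed
    have rep: "s (i + k) = s (j + k)"
      if "i < j" "j \<le> n" "t \<in> P i n ` {\<alpha>..\<beta>}" "t \<in> P j n ` {\<alpha>..\<beta>}" "k < n + ?l - j" for i j k t
      using overlap_imp_repetition[OF that(1,2) l _ _ that(5), of t] that(3,4) sn \<alpha>\<beta>(2) by simp
    have occ_n: "n \<in> R" "\<And>m. m \<in> R \<Longrightarrow> m < n \<Longrightarrow> m + N \<le> n" using n(2) by (auto simp: M_def)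
    have nth: "s (n + k) = c ! k" if "k < ?l" for k using sn that unfolding occ_nth by blast
    \<comment> \<open>An overlap of the pullbacks to \<open>i\<close> and \<open>j\<close> copies
      the occurrence of \<open>c\<close> at \<open>n\<close> to the time
      \<open>n - (j - i)\<close>.\<close>
    have mO: "i + (n - j) \<in> R"
      if "i < j" "j \<le> n" "t \<in> P i n ` {\<alpha>..\<beta>}" "t \<in> P j n ` {\<alpha>..\<beta>}" for i j t
      unfolding R mem_Collect_eq occ_nth
    proof (intro allI impI)
      fix k assume k: "k < ?l"
      have "s (i + (n - j + k)) = s (j + (n - j + k))" using that k by (intro rep[where t = t]) auto
      then show "s (i + (n - j) + k) = c ! k" using nth[OF k] that(2) by (simp add: add.assoc)
    qed
    \<comment> \<open>A pullback is nested in another one only if it creates an earlier occurrence of \<open>c\<close>. This is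
      impossible within distance \<open>N\<close> of \<open>n\<close>; farther away, that occurrence would again follow a gap
      of length \<open>N\<close>. Hence each of the two ranges gives disjoint pullbacks.\<close>
    let ?F1 = "{k \<in> {n'..<n}. k + N \<le> n}" and ?F2 = "{k \<in> {n'..<n}. n < k + N}"
    have "(\<Sum>k\<in>?F1. \<bar>P k n \<alpha> - P k n \<beta>\<bar>) \<le> len"
    proof (rule disjoint_pullbacks_sum[OF _ \<alpha>\<beta>(1) J])
      fix i j assume i: "i \<in> ?F1" and j: "j \<in> ?F1" and ij: "i < j"
      show "P i n ` {\<alpha>..\<beta>} \<inter> P j n ` {\<alpha>..\<beta>} = {}"
      proof (rule ccontr)
        assume "\<not> ?thesis"
        then obtain t where t: "t \<in> P i n ` {\<alpha>..\<beta>}" "t \<in> P j n ` {\<alpha>..\<beta>}" by blast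
        have jn: "j \<le> n" using j by simp
        let ?m = "i + (n - j)"
        have "?m \<in> M" unfolding M_def mem_Collect_eq
        proof (intro conjI ballI impI)
          show "?m \<in> R" by (rule mO[OF ij jn t])
          fix m' assume m': "m' \<in> R" "m' < ?m"
          \<comment> \<open>An occurrence shortly before \<open>?m\<close> would be carried forward
            by \<open>j - i\<close> to one shortly before \<open>n\<close>. The condition
            \<open>j + N \<le> n\<close> from \<open>?F1\<close> keeps it inside the repeated
            stretch.\<close>
          show "m' + N \<le> ?m"
          proof (rule ccontr)
            assume neg: "\<not> ?thesis"
            define e where "e = ?m - m'"
            have e: "e > 0" "e < N" "m' = ?m - e" "e \<le> ?m" using m'(2) neg by (auto simp: e_def)
            have en: "j + e \<le> n" using e(2) j by auto
            have "n - e \<in> R" unfolding R mem_Collect_eq occ_nth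
            proof (intro allI impI)
              fix k assume k: "k < ?l"
              have "s (i + (n - e - j + k)) = s (j + (n - e - j + k))"
                using k jn en by (intro rep[OF ij jn t]) auto
              moreover have "i + (n - e - j + k) = m' + k" "j + (n - e - j + k) = n - e + k"
                using e(3) en by auto
              moreover have "s (m' + k) = c ! k" using m'(1) k unfolding R mem_Collect_eq occ_nth by blast
              ultimately show "s (n - e + k) = c ! k" by metis
            qed
            then show False using occ_n(2)[of "n - e"] e(1,2) en by auto
          qed
        qed
        then show False using cons[of ?m] i j ij by auto
      qed
    qed simp
    moreover have "(\<Sum>k\<in>?F2. \<bar>P k n \<alpha> - P k n \<beta>\<bar>) \<le> len"
    proof (rule disjoint_pullbacks_sum[OF _ \<alpha>\<beta>(1) J])
      fix i j assume i: "i \<in> ?F2" and j: "j \<in> ?F2" and ij: "i < j"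
      show "P i n ` {\<alpha>..\<beta>} \<inter> P j n ` {\<alpha>..\<beta>} = {}"
      proof (rule ccontr)
        assume "\<not> ?thesis"
        then obtain t where t: "t \<in> P i n ` {\<alpha>..\<beta>}" "t \<in> P j n ` {\<alpha>..\<beta>}" by blast
        have jn: "j \<le> n" using j by simp
        have "i + (n - j) < n" using ij jn by linarith
        then have "i + (n - j) + N \<le> n" by (rule occ_n(2)[OF mO[OF ij jn t]])
        moreover have "n < i + N" using i by simp
        ultimately show False by linarith
      qed
    qed simp
    moreover have "(\<Sum>k\<in>{n'..<n}. \<bar>P k n \<alpha> - P k n \<beta>\<bar>) =
        (\<Sum>k\<in>?F1. \<bar>P k n \<alpha> - P k n \<beta>\<bar>) + (\<Sum>k\<in>?F2. \<bar>P k n \<alpha> - P k n \<beta>\<bar>)"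
      by (subst sum.union_disjoint[symmetric]) (auto intro!: sum.cong)
    ultimately show "(\<Sum>k\<in>{n'..<n}. \<bar>P k n \<alpha> - P k n \<beta>\<bar>) \<le> C" unfolding C_def by linarith
  qed
qed

section \<open>Extremal cylinders\<close>

text \<open>Let \<open>A\<close> reach from the left end of \<open>cyl w\<close> to the right end of the enclosing interval
  \<open>J (s n)\<close>. Since no orbit point lies to the right of \<open>cyl w\<close>, pullbacks of \<open>A\<close> from an
  occurrence \<open>n\<close> of \<open>w\<close> meet \<open>A\<close> only at other occurrences. The size of \<open>A\<close> stays bounded below
  however long \<open>w\<close> is.\<close>

lemma extremal_overlap:
  assumes w: "w \<noteq> []" and m: "m < n" and occ: "map s [n..<n + length w] = w"
    and notocc: "map s [m..<m + length w] \<noteq> w"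
    and cyl: "cyl w = {\<alpha>..b}" and top: "\<And>k. k \<ge> m \<Longrightarrow> y k \<le> b"
    and t: "\<alpha> \<le> t" "t \<in> J (s n)" "\<alpha> \<le> P m n t" "P m n t \<in> J (s n)"
  shows False
proof -
  let ?l = "length w" and ?d = "n - m"
  have l: "?l > 0" using w by simp
  have sw: "set w \<subseteq> {1..p}" using s_word[of "[n..<n + ?l]"] occ by simp
  have yn: "y n \<in> cyl w" using y_cyl[OF l, of n] occ by simp
  have \<alpha>b: "\<alpha> \<le> b" "\<alpha> \<in> cyl w" using yn cyl by auto
  have ym: "y m < \<alpha>"
  proof (rule ccontr)
    assume "\<not> y m < \<alpha>"
    then have "y m \<in> cyl w" using top[of m] cyl by simp
    then have "map s [m..<m + ?l] = take (length (map s [m..<m + ?l])) w"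
      using w by (intro cyl_meet_prefix[OF s_word sw _ _ y_cyl[OF l, of m]]) simp_all
    then show False using notocc by simp
  qed
  let ?v = "map s [m..<n]" and ?va = "map s [m..<n] @ [s n]"
  have va: "map s [m..<m + Suc ?d] = ?va" using m by simp
  have cva: "cyl ?va = P m n ` J (s n)" by (rule cyl_P)
  have sva: "set ?va \<subseteq> {1..p}" using s_word[of "[m..<n]"] s_in[of n] by simp
  \<comment> \<open>This interval has points on both sides of \<alpha>, hence contains \<alpha>. So
    one of \<open>w\<close> and \<open>?va\<close> is a prefix of the other, and \<open>w\<close>
    must be the longer one because it does not occur at \<open>m\<close>.\<close>
  have "y m \<in> cyl ?va" using y_cyl[of "Suc ?d" m] va by simp
  moreover have "P m n t \<in> cyl ?va" using t(2) cva by blast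
  moreover obtain a1 b1 where "cyl ?va = {a1..b1}" using cyl_interval[OF sva] by blast
  ultimately have \<alpha>va: "\<alpha> \<in> cyl ?va" using ym t(3) by auto
  have short: "Suc ?d < ?l"
  proof (rule ccontr)
    assume "\<not> ?thesis"
    then have len: "?l \<le> length ?va" by simp
    have "w = take ?l ?va" by (rule cyl_meet_prefix[OF sw sva w len \<alpha>b(2) \<alpha>va])
    also have "\<dots> = take ?l (map s [m..<m + Suc ?d])" using va by simp
    also have "\<dots> = map s [m..<m + ?l]" using len m by (simp add: take_map del: upt_Suc)
    finally show False using notocc by simp
  qed
  have "?va = take (length ?va) w"
    using short by (intro cyl_meet_prefix[OF sva sw _ _ \<alpha>va \<alpha>b(2)]) simp_all
  then have vw: "?v = take ?d w"
    by (metis append_eq_conv_conj append_take_drop_id append.assoc length_map length_upt)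
  define w2 where "w2 = drop ?d w"
  have wv: "w = ?v @ w2" using vw by (simp add: w2_def)
  have w2: "w2 \<noteq> []" "length w2 = ?l - ?d" using short by (auto simp: w2_def)
  have sw2: "set w2 \<subseteq> {1..p}" using sw wv by (metis le_sup_iff set_append)
  have cylw: "cyl w = P m n ` cyl w2"
    using cyl_append[OF w2(1), of ?v] wv by (simp add: P_def)
  have occ2: "map s [n + ?d..<n + ?d + length w2] = w2"
  proof -
    have "drop ?d (map s [n..<n + ?l]) = map s [n + ?d..<n + ?l]" by (simp add: drop_map)
    then show ?thesis using occ short w2 by (simp add: w2_def)
  qed
  have y2: "y (n + ?d) \<in> cyl w2" using y_cyl[of "length w2" "n + ?d", unfolded occ2] w2(1) by simp
  have ynP: "y m = P m n (y n)" using y_P[of m n] m by simp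
  have yn2: "y n \<notin> cyl w2" 
  proof
    assume "y n \<in> cyl w2"
    then have "y m \<in> cyl w" using cylw ynP by simp
    then show False using ym cyl by simp
  qed
  have disj: "cyl w2 \<inter> cyl w = {}"
  proof (rule ccontr)
    assume "\<not> ?thesis"
    then obtain u where "u \<in> cyl w2" "u \<in> cyl w" by blast
    then have "w2 = take (length w2) w" using w2 by (intro cyl_meet_prefix[OF sw2 sw]) auto
    then have "cyl w \<subseteq> cyl w2"
      using cyl_mono[of w2 "drop (length w2) w"] w2(1) sw by (metis append_take_drop_id)
    then show False using yn yn2 by blast
  qed
  obtain q where q: "q \<in> cyl w2" "P m n q = \<alpha>" using \<alpha>b(2) cylw by auto
  obtain a2 b2 where c2: "cyl w2 = {a2..b2}" using cyl_interval[OF sw2 w2(1)] by blast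
  \<comment> \<open>Were \<open>q\<close> to the right of \<open>cyl w\<close>, the interval
    \<open>cyl w2\<close> would contain \<open>b\<close>, since it also contains the orbit point
    \<open>y (n + ?d)\<close>, which is at most \<open>b\<close>.\<close>
  have "q < \<alpha>"
  proof (rule ccontr)
    assume "\<not> q < \<alpha>"
    then have "q > b" using q(1) disj cyl by force
    moreover have "y (n + ?d) \<le> b" using top[of "n + ?d"] m by simp
    ultimately have "b \<in> cyl w2" using q(1) y2 c2 by auto
    then show False using disj cyl \<alpha>b(1) by force
  qed
  then have qt: "q < t" "q < y n" using t(1) yn cyl by auto
  have hd: "hd w2 = s n"
  proof -
    have "?va @ drop (Suc ?d) w = w"
      using \<open>?va = take (length ?va) w\<close> m append_take_drop_id[of "Suc ?d" w] by (simp del: append_assoc)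
    then have "w2 = s n # drop (Suc ?d) w" using wv by (metis append.assoc append_Cons append_Nil same_append_eq)
    then show ?thesis by simp
  qed
  have qJ: "q \<in> J (s n)" using cyl_J_hd[OF sw2 w2(1)] q(1) hd by auto
  have inj: "inj_on (P m n) B" unfolding P_def by (rule G_inj[OF s_word])
  have B: "q \<in> B" "t \<in> B" using qJ t(2) J_subset_B[OF s_in] by auto
  have ne: "P m n t \<noteq> \<alpha>" using inj_onD[OF inj, of t q] B q(2) qt(1) by auto
  then have gt: "P m n t > \<alpha>" using t(3) by simp
  have seg: "P m n ` closed_segment u1 u2 = closed_segment (P m n u1) (P m n u2)"
    if "u1 \<in> J (s n)" "u2 \<in> J (s n)" for u1 u2
    unfolding P_def by (rule G_segment[OF s_word s_in that])
  \<comment> \<open>\<open>P m n\<close> is monotone on \<open>J (s n)\<close> and takes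
    \<open>q\<close> to \<alpha>. Yet it takes the larger point \<open>y n\<close> to the left of
    \<alpha> and the larger point \<open>t\<close> to the right of it.\<close>
  show False
  proof (cases "y n \<le> t")
    case True
    then have "y n \<in> closed_segment q t" using qt by (simp add: closed_segment_eq_real_ivl)
    then have "P m n (y n) \<in> closed_segment \<alpha> (P m n t)" using seg[OF qJ t(2)] q(2) by blast
    then show False using ynP ym gt by (simp add: closed_segment_eq_real_ivl)
  next
    case False
    then have "t \<in> closed_segment q (y n)" using qt by (simp add: closed_segment_eq_real_ivl)
    then have "P m n t \<in> closed_segment \<alpha> (P m n (y n))" using seg[OF qJ y_J] q(2) by blast
    then show False using ynP ym gt by (simp add: closed_segment_eq_real_ivl)
  qed
qed

text \<open>Applies \<open>in_H_set_if_gaps\<close> to \<open>{\<alpha>..hi (hd w)}\<close>. Between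
  consecutive occurrences of \<open>w\<close> its pullbacks are disjoint by
  \<open>extremal_overlap\<close>, so \<open>len\<close> bounds their total length.\<close>

lemma in_H_set_if_extremal:
  assumes w: "w \<noteq> []" "set w \<subseteq> {1..p}" and O: "infinite {n. map s [n..<n + length w] = w}"
    and cyl: "cyl w = {\<alpha>..b}" and top: "\<And>n. n \<ge> n0 \<Longrightarrow> y n \<le> b"
    and L: "distortion_const L"
    and small: "\<And>v t1 t2. set v \<subseteq> {1..p} \<Longrightarrow> length v \<ge> N \<Longrightarrow> t1 \<in> cyl v \<Longrightarrow> t2 \<in> cyl v \<Longrightarrow>
      \<bar>t1 - t2\<bar> < (hi (hd w) - \<alpha>) / (2 * exp (L * (len + len)))"
    and gap: "\<And>n' n. map s [n'..<n' + length w] = w \<Longrightarrow> map s [n..<n + length w] = w \<Longrightarrow> n' < n \<Longrightarrow> n' + N \<le> n"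
    and x: "y 0 \<in> Lambda_Q p J g Q"
  shows "y 0 \<in> H_set p J g Q"
proof -
  define M where "M = {n. map s [n..<n + length w] = w} \<inter> {n0..}"
  have h: "hd w \<in> {1..p}" by (rule hd_in_alphabet[OF w(2,1)])
  have sub: "{\<alpha>..b} \<subseteq> {lo (hd w)..hi (hd w)}" "\<alpha> < b"
  proof -
    show "{\<alpha>..b} \<subseteq> {lo (hd w)..hi (hd w)}" using cyl_J_hd[OF w(2,1)] J_eq[OF h] cyl by simp
    obtain a1 b1 where "a1 < b1" "cyl w = {a1..b1}" using cyl_interval[OF w(2,1)] by blast
    then show "\<alpha> < b" using cyl by (metis Icc_eq_Icc less_imp_le)
  qed
  then have \<alpha>\<beta>: "\<alpha> < hi (hd w)" "{\<alpha>..hi (hd w)} \<subseteq> J (hd w)" "cyl w \<subseteq> {\<alpha>..hi (hd w)}"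
    using J_eq[OF h] cyl by auto
  have occ: "map s [n..<n + length w] = w" if "n \<in> M" for n using that by (simp add: M_def)
  show ?thesis
  proof (rule in_H_set_if_gaps[OF _ w(1) occ L \<alpha>\<beta>(1,3,2) small _ _ len_nonneg x])
    have "{n. map s [n..<n + length w] = w} \<subseteq> M \<union> {..<n0}" by (auto simp: M_def)
    then show "infinite M" using O finite_subset by fastforce
    show "n' + N \<le> n" if "n' \<in> M" "n \<in> M" "n' < n" for n' n using that gap by (simp add: M_def)
  next
    fix n' n
    assume n: "n' \<in> M" "n \<in> M" "n' < n" and cons: "\<And>m. m \<in> M \<Longrightarrow> m \<le> n' \<or> n \<le> m"
    have sn: "s n = hd w"
    proof -
      have "map s [n..<n + length w] = s n # map s [Suc n..<n + length w]"
        using w by (intro map_upt_Cons) auto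
      then show ?thesis using occ[OF n(2)] by (metis list.sel(1))
    qed
    let ?A = "{\<alpha>..hi (hd w)}"
    have J: "?A \<subseteq> J (s n)" using \<alpha>\<beta>(2) sn by simp
    show "(\<Sum>k\<in>{n'..<n}. \<bar>P k n \<alpha> - P k n (hi (hd w))\<bar>) \<le> len"
    proof (rule disjoint_pullbacks_sum[OF _ \<alpha>\<beta>(1) J])
      fix i j assume i: "i \<in> {n'..<n}" and j: "j \<in> {n'..<n}" and ij: "i < j"
      show "P i n ` ?A \<inter> P j n ` ?A = {}"
      proof (rule ccontr)
        assume ne: "P i n ` ?A \<inter> P j n ` ?A \<noteq> {}"
        obtain u where u: "u \<in> P i n ` ?A \<inter> P j n ` ?A" using ex_in_conv[THEN iffD2, OF ne] by (rule exE)
        obtain t where t1: "u = P i n t" "t \<in> ?A" using IntD1[OF u] by (rule imageE)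
        obtain t' where t2: "u = P j n t'" "t' \<in> ?A" using IntD2[OF u] by (rule imageE)
        have t: "t \<in> ?A" "t' \<in> ?A" "P i n t = P j n t'"
          by (rule t1, rule t2, rule trans[OF t1(1)[symmetric] t2(1)])
        \<comment> \<open>The letters from \<open>i\<close> and from \<open>j\<close> agree for
          \<open>n - j\<close> steps, so this common branch cancels. What remains is a pullback from
          \<open>n\<close> to \<open>m\<close> that meets the interval, with \<open>m\<close>
          strictly between consecutive members of \<open>M\<close>.\<close>
        define m where "m = i + (n - j)"
        have m: "n' < m" "m < n" "i \<le> m" using i j ij by (auto simp: m_def)
        have tJ: "t \<in> J (s n)" "t' \<in> J (s n)" using t J by auto
        then have tB: "t \<in> B" "t' \<in> B" using J_subset_B[OF s_in] by auto
        have c1: "cyl (map s [n..<n + 1]) = J (s n)" by (simp add: cyl_single)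
        have *: "P i n t \<in> P i n ` cyl (map s [n..<n + 1])" "P i n t \<in> P j n ` cyl (map s [n..<n + 1])"
          unfolding c1 by (rule imageI[OF tJ(1)]) (unfold t(3), rule imageI[OF tJ(2)])
        have "s (i + k) = s (j + k)" if "k < n - j" for k
          using overlap_imp_repetition[OF ij _ _ *] j that by simp
        then have "map s [i..<m] = map s [j..<n]"
          by (intro nth_equalityI) (auto simp: m_def)
        then have "P i m (P m n t) = P i m t'"
          using t(3) P_comp[of i m n t] m by (simp add: P_def)
        then have Pt: "P m n t = t'"
          using G_inj[OF s_word, of "[i..<m]"] P_in_B[OF tB(1)] tB(2) unfolding P_def by (meson inj_onD)
        have "m \<notin> M" using cons[of m] m by auto
        then have notocc: "map s [m..<m + length w] \<noteq> w" using m n(1) by (auto simp: M_def)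
        show False
          by (rule extremal_overlap[OF w(1) m(2) occ[OF n(2)] notocc cyl, of t])
            (use top m n(1) t tJ Pt in \<open>auto simp: M_def\<close>)
      qed
    qed simp
  qed
qed

section \<open>Orbits that are not eventually periodic\<close>

definition recurrent :: "nat list \<Rightarrow> bool" where
  "recurrent w \<longleftrightarrow> infinite {n. map s [n..<n + length w] = w}"

text \<open>The extremal words are the prefixes of the coding of \<open>limsup y\<close>.\<close>

definition extremal :: "nat list \<Rightarrow> bool" where
  "extremal w \<longleftrightarrow> w \<noteq> [] \<and> recurrent w \<and> (\<exists>n0. \<forall>n\<ge>n0. y n \<le> Sup (cyl w))"

lemma finite_words: "finite {w. set w \<subseteq> {1..p} \<and> length w = l}"
  by (rule finite_lists_length_eq) simp

text \<open>There are finitely many words of length \<open>l\<close>, and each one that is not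
  recurrent occurs only finitely often.\<close>

lemma eventually_recurrent: "\<exists>n0. \<forall>n\<ge>n0. recurrent (map s [n..<n + l])"
proof -
  let ?W = "{w. (set w \<subseteq> {1..p} \<and> length w = l) \<and> \<not> recurrent w}"
  define X where "X = (\<Union>w\<in>?W. {n. map s [n..<n + length w] = w})"
  have "finite X"
    unfolding X_def
  proof (rule finite_UN_I)
    show "finite ?W" using finite_words[of l] by (rule rev_finite_subset) blast
    show "finite {n. map s [n..<n + length w] = w}" if "w \<in> ?W" for w
      using that unfolding recurrent_def by blast
  qed
  then obtain n0 where n0: "\<forall>n\<in>X. n < n0"
    unfolding finite_nat_set_iff_bounded by (rule exE)
  have "recurrent (map s [n..<n + l])" if "n0 \<le> n" for n
  proof (rule ccontr)
    assume "\<not> ?thesis"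
    then have "map s [n..<n + l] \<in> ?W" using s_word[of "[n..<n + l]"] by simp
    moreover have "n \<in> {k. map s [k..<k + length (map s [n..<n + l])] = map s [n..<n + l]}" by simp
    ultimately have "n \<in> X" unfolding X_def by (rule UN_I)
    then show False using that n0 by auto
  qed
  then show ?thesis by blast
qed

lemma recurrent_alphabet: "recurrent w \<Longrightarrow> set w \<subseteq> {1..p}"
proof -
  assume "recurrent w"
  then obtain n where "map s [n..<n + length w] = w"
    unfolding recurrent_def using not_finite_existsD by blast
  then show ?thesis using s_word[of "[n..<n + length w]"] by simp
qed

lemma recurrent_at: 
  assumes "recurrent w" obtains n where "n \<ge> n0" "map s [n..<n + length w] = w"
  using assms unfolding recurrent_def infinite_nat_iff_unbounded_le by blast

text \<open>From some time on only recurrent words occur, so a recurrent word whose cylinder reaches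
  farthest to the right is extremal.\<close>

lemma extremal_exists:
  assumes "l > 0" obtains w where "length w = l" "extremal w"
proof -
  let ?R = "{w. (set w \<subseteq> {1..p} \<and> length w = l) \<and> recurrent w}"
  have fin: "finite ?R" using finite_words[of l] by (rule rev_finite_subset) blast
  obtain n0 where n0: "\<And>n. n \<ge> n0 \<Longrightarrow> recurrent (map s [n..<n + l])" using eventually_recurrent by blast
  have inR: "map s [n..<n + l] \<in> ?R" if "n \<ge> n0" for n
    using n0[OF that] s_word[of "[n..<n + l]"] by simp
  then have ne: "?R \<noteq> {}" by blast
  have "Max ((\<lambda>w. Sup (cyl w)) ` ?R) \<in> (\<lambda>w. Sup (cyl w)) ` ?R"
    using fin ne by (intro Max_in) auto
  then obtain w where w: "w \<in> ?R" "Max ((\<lambda>w. Sup (cyl w)) ` ?R) = Sup (cyl w)" by (rule imageE) simp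
  have "y n \<le> Sup (cyl w)" if "n \<ge> n0" for n
  proof -
    have yn: "y n \<in> cyl (map s [n..<n + l])" by (rule y_cyl[OF assms])
    have "map s [n..<n + l] \<noteq> []" using assms by simp
    then obtain a b where "cyl (map s [n..<n + l]) = {a..b}" using cyl_interval[OF s_word] by blast
    then have "y n \<le> Sup (cyl (map s [n..<n + l]))" using yn by simp
    also have "\<dots> \<le> Max ((\<lambda>w. Sup (cyl w)) ` ?R)"
      using fin inR[OF that] by (intro Max_ge) auto
    finally show ?thesis using w(2) by simp
  qed
  then have "extremal w" using w(1) assms unfolding extremal_def by auto
  then show ?thesis using that w(1) by blast
qed

text \<open>Otherwise the cylinders of \<open>w'\<close> and of the prefix of \<open>w\<close> are
  disjoint intervals. Both are visited at arbitrarily late times and the right end of each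
  eventually bounds the orbit, so neither can lie to the left of the other.\<close>

lemma extremal_prefix:
  assumes w: "extremal w" and w': "extremal w'" and l: "length w' \<le> length w"
  shows "w' = take (length w') w"
proof (rule ccontr)
  define u where "u = take (length w') w"
  assume "\<not> w' = take (length w') w"
  then have ne: "w' \<noteq> u" by (simp add: u_def)
  have words: "set w \<subseteq> {1..p}" "set w' \<subseteq> {1..p}" "w \<noteq> []" "w' \<noteq> []"
    using w w' recurrent_alphabet by (auto simp: extremal_def)
  have lu: "length u = length w'" using l by (simp add: u_def)
  have u: "set u \<subseteq> {1..p}" "u \<noteq> []"
    using words lu set_take_subset[of "length w'" w] by (auto simp: u_def)
  have disj: "cyl u \<inter> cyl w' = {}"
  proof (rule ccontr)
    assume "\<not> ?thesis"
    then obtain t where "t \<in> cyl u" "t \<in> cyl w'" by blast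
    then have "w' = take (length w') u"
      using lu words by (intro cyl_meet_prefix[OF words(2) u(1)]) auto
    then show False using ne lu by simp
  qed
  have sub: "cyl w \<subseteq> cyl u"
    using cyl_mono[of u "drop (length w') w"] words(1) u(2) by (simp add: u_def)
  obtain a b where ab: "cyl u = {a..b}" "a < b" using cyl_interval[OF u] by blast
  obtain a1 b1 where ab1: "cyl w = {a1..b1}" "a1 < b1" using cyl_interval[OF words(1,3)] by blast
  obtain a' b' where ab': "cyl w' = {a'..b'}" "a' < b'" using cyl_interval[OF words(2,4)] by blast
  have b1: "b1 \<le> b" using sub ab ab1 by auto
  obtain n0 where n0: "\<And>n. n \<ge> n0 \<Longrightarrow> y n \<le> b1" using w ab1 unfolding extremal_def by auto
  obtain n0' where n0': "\<And>n. n \<ge> n0' \<Longrightarrow> y n \<le> b'" using w' ab' unfolding extremal_def by auto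
  obtain n where n: "n \<ge> n0" "map s [n..<n + length w'] = w'"
    using w' recurrent_at unfolding extremal_def by blast
  obtain m where m: "m \<ge> n0'" "map s [m..<m + length w] = w"
    using w recurrent_at unfolding extremal_def by blast
  have "y n \<in> cyl w'" using y_cyl[of "length w'" n] n words by simp
  moreover have "y m \<in> cyl u" using y_cyl[of "length w" m] m words sub by auto
  moreover have "y n \<le> b" "y m \<le> b'" using n0[OF n(1)] n0'[OF m(1)] b1 by auto
  ultimately have "max a a' \<in> cyl u \<inter> cyl w'" unfolding ab(1) ab'(1) by auto
  then show False using disj by blast
qed

lemma extremal_sequence:
  obtains \<zeta> where "\<And>l. l > 0 \<Longrightarrow> extremal (map \<zeta> [0..<l])"
proof -
  have "\<forall>l. \<exists>w. length w = Suc l \<and> extremal w" using extremal_exists by (metis zero_less_Suc)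
  then obtain W where W: "\<And>l. length (W l) = Suc l" "\<And>l. extremal (W l)" by metis
  \<comment> \<open>The words \<open>W l\<close> are prefixes of one another, so their diagonal
    letters form one sequence that has all of them as prefixes.\<close>
  define \<zeta> where "\<zeta> k = W k ! k" for k
  have "map \<zeta> [0..<Suc l] = W l" for l
  proof (rule nth_equalityI)
    show "length (map \<zeta> [0..<Suc l]) = length (W l)" using W by simp
    fix k assume "k < length (map \<zeta> [0..<Suc l])"
    then have k: "k < Suc l" by simp
    have "W k = take (length (W k)) (W l)" using W k by (intro extremal_prefix) auto
    then have "W k ! k = W l ! k" using W(1)[of k] by (metis lessI nth_take)
    then show "map \<zeta> [0..<Suc l] ! k = W l ! k" using k by (simp add: \<zeta>_def del: upt_Suc)
  qed
  then have "extremal (map \<zeta> [0..<l])" if "l > 0" for l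
    using W(2)[of "l - 1"] that by (metis Suc_pred')
  then show ?thesis using that by blast
qed

text \<open>A return to a prefix after \<open>q\<close> steps makes \<open>\<zeta>\<close> agree
  with its shift by \<open>q\<close> along the overlap. A prefix long enough to refute every period
  below \<open>N\<close> has no return time below \<open>N\<close>.\<close>

lemma in_H_set_if_extremal_aperiodic:
  assumes \<zeta>: "\<And>l. l > 0 \<Longrightarrow> extremal (map \<zeta> [0..<l])"
    and aper: "\<And>q. q > 0 \<Longrightarrow> \<exists>k. \<zeta> (k + q) \<noteq> \<zeta> k"
    and x: "y 0 \<in> Lambda_Q p J g Q"
  shows "y 0 \<in> H_set p J g Q"
proof -
  obtain L where L: "distortion_const L" using distortion_const_exists by blast
  obtain \<delta> where \<delta>: "\<delta> > 0" "\<And>i t. i \<in> {1..p} \<Longrightarrow> t \<in> B \<Longrightarrow> lo i + \<delta> \<le> g i t \<and> g i t \<le> hi i - \<delta>"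
    by (rule g_margin) blast
  \<comment> \<open>\<open>N\<close> can be chosen before \<open>w\<close> because \<delta> bounds
    the length of \<open>{\<alpha>..hi (hd w)}\<close> from below for every word of length at least
    2.\<close>
  have "\<delta> / (2 * exp (L * (len + len))) > 0" using \<delta>(1) by simp
  then obtain N where N: "\<And>v t1 t2. set v \<subseteq> {1..p} \<Longrightarrow> length v \<ge> N \<Longrightarrow> t1 \<in> cyl v \<Longrightarrow> t2 \<in> cyl v \<Longrightarrow>
      \<bar>t1 - t2\<bar> < \<delta> / (2 * exp (L * (len + len)))" by (rule cyl_small) blast
  obtain d where d: "\<And>q. q > 0 \<Longrightarrow> \<zeta> (d q + q) \<noteq> \<zeta> (d q)" using aper by metis
  \<comment> \<open>Longer than \<open>d q + q\<close> for every \<open>q < N\<close>; the summand 2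
    puts \<alpha> into the image of a branch, where the margin \<delta> is available.\<close>
  define l where "l = 2 + N + (\<Sum>q<N. d q)"
  have dl: "d q + q < l" if "q < N" for q
    using member_le_sum[of q "{..<N}" d] that by (simp add: l_def)
  define w where "w = map \<zeta> [0..<l]"
  have l: "length w = l" "l \<ge> 2" by (auto simp: w_def l_def)
  have ex: "extremal w" unfolding w_def using l by (intro \<zeta>) auto
  have w: "w \<noteq> []" "set w \<subseteq> {1..p}" "recurrent w" using ex recurrent_alphabet by (auto simp: extremal_def)
  obtain \<alpha> b where \<alpha>b: "\<alpha> < b" "cyl w = {\<alpha>..b}" using cyl_interval[OF w(2,1)] by blast
  obtain n0 where n0: "\<And>n. n \<ge> n0 \<Longrightarrow> y n \<le> b" using ex \<alpha>b by (auto simp: extremal_def)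
  have "\<alpha> \<le> hi (hd w) - \<delta>"
  proof -
    obtain i v where iv: "w = i # v" using w(1) by (cases w) auto
    have "v \<noteq> []" using l iv by auto
    note iv = iv this
    have "\<alpha> \<in> cyl w" using \<alpha>b by simp
    then obtain t where t: "t \<in> cyl v" "\<alpha> = g i t" using cyl_Cons[OF iv(2), of i] iv(1) by auto
    then have "t \<in> B" using cyl_subset_B[of v] iv w by auto
    then show ?thesis using \<delta>(2)[of i t] t(2) iv w(2) by simp
  qed
  then have "\<delta> / (2 * exp (L * (len + len))) \<le> (hi (hd w) - \<alpha>) / (2 * exp (L * (len + len)))"
    by (intro divide_right_mono) auto
  then have small: "\<bar>t1 - t2\<bar> < (hi (hd w) - \<alpha>) / (2 * exp (L * (len + len)))"
    if "set v \<subseteq> {1..p}" "length v \<ge> N" "t1 \<in> cyl v" "t2 \<in> cyl v" for v t1 t2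
    using N[OF that] by linarith
  show ?thesis
  proof (rule in_H_set_if_extremal[OF w(1,2) w(3)[unfolded recurrent_def] \<alpha>b(2) n0 L small _ x])
    fix n' n assume occ: "map s [n'..<n' + length w] = w" "map s [n..<n + length w] = w" and n: "n' < n"
    show "n' + N \<le> n"
    proof (rule ccontr)
      assume neg: "\<not> ?thesis"
      define q where "q = n - n'"
      have q: "q > 0" "q < N" "n = n' + q" using n neg by (auto simp: q_def)
      have s1: "s (n' + (d q + q)) = \<zeta> (d q + q)"
        using occ(1) dl[OF q(2)] l(1) unfolding occ_nth by (simp add: w_def)
      have s2: "s (n + d q) = \<zeta> (d q)"
        using occ(2) dl[OF q(2)] l(1) unfolding occ_nth by (simp add: w_def)
      have "n' + (d q + q) = n + d q" using q(3) by simp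
      then show False using s1 s2 d[OF q(1)] by metis
    qed
  qed
qed

text \<open>A word that violates the period recurs, but it cannot occur while the orbit follows
  \<open>\<zeta>\<close>. Since prefixes of \<open>\<zeta>\<close> of every length recur, the gaps
  of that word are unbounded.\<close>

lemma in_H_set_if_extremal_periodic:
  assumes \<zeta>: "\<And>l. l > 0 \<Longrightarrow> extremal (map \<zeta> [0..<l])"
    and q: "q > 0" "\<And>k. \<zeta> (k + q) = \<zeta> k"
    and aper: "infinite {n. s (n + q) \<noteq> s n}"
    and x: "y 0 \<in> Lambda_Q p J g Q"
  shows "y 0 \<in> H_set p J g Q"
proof -
  let ?D = "{n. s (n + q) \<noteq> s n}"
  let ?h = "\<lambda>n. map s [n..<n + Suc q]"
  have "?h ` ?D \<subseteq> {w. set w \<subseteq> {1..p} \<and> length w = Suc q}"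
  proof (intro image_subsetI CollectI conjI)
    show "set (?h n) \<subseteq> {1..p}" for n by (rule s_word)
  qed simp
  then have "finite (?h ` ?D)" using finite_words by (rule finite_subset)
  \<comment> \<open>Infinitely many violations share finitely many words of length
    \<open>q + 1\<close>, so one such word recurs. Its first and last letters differ.\<close>
  then obtain n1 where n1: "n1 \<in> ?D" "infinite {n \<in> ?D. ?h n = ?h n1}"
    using pigeonhole_infinite[OF aper] by blast
  define c where "c = ?h n1"
  have c: "length c = Suc q" "c \<noteq> []" by (auto simp: c_def simp del: upt_Suc)
  have cq: "c ! q \<noteq> c ! 0"
    using n1(1) by (simp add: c_def nth_append del: upt_Suc)
  define R where "R = {n. map s [n..<n + length c] = c}"
  have inf: "infinite R"
    using n1(2) by (rule infinite_super[rotated]) (auto simp: R_def c_def simp del: upt_Suc)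
  show ?thesis
  proof (rule in_H_set_if_unbounded_gaps[OF c(2) R_def _ x])
    fix N
    show "infinite {n \<in> R. \<forall>m\<in>R. m < n \<longrightarrow> m + N \<le> n}"
      unfolding infinite_nat_iff_unbounded_le
    proof
      fix b
      let ?w = "map \<zeta> [0..<N + Suc q]"
      have "recurrent ?w" using \<zeta>[of "N + Suc q"] by (simp add: extremal_def)
      then obtain m where m: "m \<ge> b" "map s [m..<m + length ?w] = ?w" by (rule recurrent_at)
      have z: "s (m + k) = \<zeta> k" if "k < N + Suc q" for k
        using m(2) that unfolding occ_nth by (simp del: upt_Suc)
      have none: "m + k \<notin> R" if "k < N" for k
      proof
        assume "m + k \<in> R"
        then have "map s [m + k..<m + k + length c] = c" by (simp add: R_def)
        then have "s (m + k + 0) = c ! 0" "s (m + k + q) = c ! q"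
          unfolding occ_nth using c(1) by (metis zero_less_Suc, metis lessI)
        moreover have "s (m + k + 0) = \<zeta> k" "s (m + k + q) = \<zeta> (k + q)"
          using z[of k] z[of "k + q"] that by (auto simp: add.assoc)
        ultimately show False using cq q(2) by simp
      qed
      obtain n' where "n' \<ge> m" "n' \<in> R" using inf unfolding infinite_nat_iff_unbounded_le by blast
      then have ex: "\<exists>n. m \<le> n \<and> n \<in> R" by blast
      \<comment> \<open>The first occurrence of \<open>c\<close> from \<open>m\<close> on. Earlier
        occurrences lie before \<open>m\<close>, and the \<open>N\<close> times from
        \<open>m\<close> on have none.\<close>
      define n where "n = (LEAST n. m \<le> n \<and> n \<in> R)"
      have n: "m \<le> n" "n \<in> R" using LeastI_ex[OF ex] by (auto simp: n_def)
      have least: "m' < m" if "m' \<in> R" "m' < n" for m'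
        using not_less_Least[of m' "\<lambda>n. m \<le> n \<and> n \<in> R"] that by (auto simp: n_def)
      have "m + N \<le> n"
      proof (rule ccontr)
        assume "\<not> ?thesis"
        then have "n - m < N" "m + (n - m) = n" using n(1) by auto
        then show False using none[of "n - m"] n(2) by simp
      qed
      then have "n \<in> {n \<in> R. \<forall>m\<in>R. m < n \<longrightarrow> m + N \<le> n}"
        using n(2) least by fastforce
      moreover have "b \<le> n" using m(1) n(1) by simp
      ultimately show "\<exists>n\<ge>b. n \<in> {n \<in> R. \<forall>m\<in>R. m < n \<longrightarrow> m + N \<le> n}" by blast
    qed
  qed
qed

lemma in_H_set_if_aperiodic:
  assumes aper: "\<And>q. q > 0 \<Longrightarrow> infinite {n. s (n + q) \<noteq> s n}"
    and x: "y 0 \<in> Lambda_Q p J g Q"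
  shows "y 0 \<in> H_set p J g Q"
proof -
  obtain \<zeta> where \<zeta>: "\<And>l. l > 0 \<Longrightarrow> extremal (map \<zeta> [0..<l])" by (rule extremal_sequence) blast
  show ?thesis
  proof (cases "\<exists>q>0. \<forall>k. \<zeta> (k + q) = \<zeta> k")
    case True
    then obtain q where "q > 0" "\<And>k. \<zeta> (k + q) = \<zeta> k" by blast
    then show ?thesis using in_H_set_if_extremal_periodic[OF \<zeta>] aper x by blast
  next
    case False
    then show ?thesis using in_H_set_if_extremal_aperiodic[OF \<zeta>] x by blast
  qed
qed

section \<open>Eventually periodic orbits\<close>

lemma y_interior: "lo (s n) < y n" "y n < hi (s n)"
  using g_interior[OF s_in y_B, of n "Suc n"] y_step[of n] J_eq[OF s_in, of n] by auto

lemma deriv_iterate_y: "deriv (f ^^ k) (y n) = inverse (Gd (map s [n..<n + k]) (y (n + k)))"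
  using DERIV_imp_deriv[OF iterate_deriv[OF s_word s_in y_interior, of "[n..<n + k]" "n + k"]] y_P[of n "n + k"]
  by (simp add: P_def)

lemma Gd_bounded:
  assumes "set u \<subseteq> {1..p}" obtains b where "b \<ge> 0" "\<And>t. t \<in> B \<Longrightarrow> \<bar>Gd u t\<bar> \<le> b"
proof -
  have "bounded (Gd u ` B)"
    by (intro compact_imp_bounded compact_continuous_image Gd_cont compact_B assms)
  then obtain b where "\<forall>x\<in>Gd u ` B. norm x \<le> b" by (auto simp: bounded_iff)
  then show ?thesis using that[of "max b 0"] by fastforce
qed

context
  fixes m q :: nat
  assumes q: "q > 0" and per: "\<And>n. n \<ge> m \<Longrightarrow> s (n + q) = s n"
begin

lemma s_periodic: "n \<ge> m \<Longrightarrow> s (n + k * q) = s n"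
proof (induction k)
  case (Suc k)
  then show ?case using per[of "n + k * q"] by (simp add: add_ac)
qed simp

lemma map_s_periodic: "j \<ge> m \<Longrightarrow> map s [j + k * q..<n + k * q] = map s [j..<n]"
proof (rule nth_equalityI)
  assume j: "j \<ge> m"
  fix i assume "i < length (map s [j + k * q..<n + k * q])"
  moreover have "s (j + k * q + i) = s (j + i)"
    using s_periodic[of "j + i" k] j by (simp add: add_ac)
  ultimately show "map s [j + k * q..<n + k * q] ! i = map s [j..<n] ! i" by simp
qed simp

lemma y_periodic: "n \<ge> m \<Longrightarrow> y (n + k * q) = y n"
proof -
  assume "n \<ge> m"
  then have "s (n + k * q + i) = s (n + i)" for i
    using s_periodic[of "n + i" k] by (simp add: add_ac)
  then show ?thesis by (simp add: y_def)
qed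

text \<open>By continuity the derivative of the return branch is at most some
  \<open>\<rho> < 1\<close> on a whole cylinder around \<open>y m\<close>, and
  \<open>m + k * q\<close> are return times to this cylinder.\<close>

lemma in_H_set_if_hyperbolic:
  assumes hyp: "\<bar>Gd (map s [m..<m + q]) (y m)\<bar> < 1" and x: "y 0 \<in> Lambda_Q p J g Q"
  shows "y 0 \<in> H_set p J g Q"
proof -
  let ?u = "map s [m..<m + q]"
  define \<rho> where "\<rho> = (1 + \<bar>Gd ?u (y m)\<bar>) / 2"
  have \<rho>: "0 \<le> \<rho>" "\<rho> < 1" "\<rho> - \<bar>Gd ?u (y m)\<bar> > 0" using hyp by (auto simp: \<rho>_def)
  obtain \<eta> where \<eta>: "\<eta> > 0" "\<And>t. t \<in> B \<Longrightarrow> dist t (y m) < \<eta> \<Longrightarrow> dist (Gd ?u t) (Gd ?u (y m)) < \<rho> - \<bar>Gd ?u (y m)\<bar>"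
    using Gd_cont[OF s_word, of "[m..<m + q]"] \<rho>(3) y_B[of m] unfolding continuous_on_iff by blast
  obtain N where N: "\<And>v t1 t2. set v \<subseteq> {1..p} \<Longrightarrow> length v \<ge> N \<Longrightarrow> t1 \<in> cyl v \<Longrightarrow> t2 \<in> cyl v \<Longrightarrow> \<bar>t1 - t2\<bar> < \<eta>"
    using cyl_small[OF \<eta>(1)] by blast
  define w where "w = map s [m..<m + Suc N]"
  have w: "w \<noteq> []" "length w = Suc N" "set w \<subseteq> {1..p}" "hd w = s m"
    using s_word[of "[m..<m + Suc N]"] by (auto simp: w_def hd_map simp del: upt_Suc)
  have ymw: "y m \<in> cyl w" unfolding w_def by (rule y_cyl) simp
  have small: "\<bar>Gd ?u t\<bar> \<le> \<rho>" if "t \<in> cyl w" for t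
  proof -
    have "\<bar>t - y m\<bar> < \<eta>" using N[OF w(3) _ that ymw] w(2) by simp
    moreover have "t \<in> B" using cyl_subset_B[OF w(3,1)] that by blast
    ultimately show ?thesis using \<eta>(2)[of t] by (simp add: dist_real_def)
  qed
  define M where "M = range (\<lambda>k. m + k * q)"
  have "inj (\<lambda>k. m + k * q)" using q by (simp add: inj_on_def)
  then have M: "infinite M" unfolding M_def by (rule range_inj_infinite)
  have occ: "map s [n..<n + length w] = w" if n: "n \<in> M" for n
  proof -
    obtain k where "n = m + k * q" using n by (auto simp: M_def)
    then show ?thesis
      using map_s_periodic[of m k "m + Suc N"] w(2) by (simp add: w_def add_ac del: upt_Suc)
  qed
  \<comment> \<open>Inside a period crude bounds on the derivatives of the partial branches suffice;
    they are summed over the \<open>q\<close> positions.\<close>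
  have "\<forall>i. \<exists>b\<ge>0. \<forall>t\<in>B. \<bar>Gd (map s [m + i..<m + q]) t\<bar> \<le> b"
    using Gd_bounded[OF s_word] by metis
  then obtain b where b: "\<And>i. b i \<ge> 0" "\<And>i t. t \<in> B \<Longrightarrow> \<bar>Gd (map s [m + i..<m + q]) t\<bar> \<le> b i"
    by metis
  show ?thesis
  proof (rule in_H_set_if_contracting[OF M w(1) occ \<rho>(1,2) _ _ _ x, where b = "\<Sum>i<q. b i"])
    show "0 \<le> (\<Sum>i<q. b i)" using b(1) by (intro sum_nonneg)
  next
    fix n' n t1 t2
    assume n: "n' \<in> M" "n \<in> M" "n' < n" and cons: "\<And>k. k \<in> M \<Longrightarrow> k \<le> n' \<or> n \<le> k"
      and t: "t1 \<in> cyl w" "t2 \<in> cyl w"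
    obtain k where k: "n' = m + k * q" using n(1) by (auto simp: M_def)
    obtain k' where k': "n = m + k' * q" using n(2) by (auto simp: M_def)
    have "k < k'" using n(3) q k k' by simp
    have "m + Suc k * q \<in> M" unfolding M_def by blast
    then have "n \<le> m + Suc k * q" using cons[of "m + Suc k * q"] k q by auto
    then have "k' = Suc k" using \<open>k < k'\<close> q k' by (simp add: Suc_leI le_antisym del: mult_Suc)
    then have nk: "n = n' + q" using k k' by simp
    have word: "map s [n' + i..<n] = map s [m + i..<m + q]" for i
      using map_s_periodic[of "m + i" k "m + q"] k nk by (simp add: add_ac)
    have tJ: "t1 \<in> J (s m)" "t2 \<in> J (s m)" using t cyl_J_hd[OF w(3,1)] w(4) by auto
    have tB: "t1 \<in> B" "t2 \<in> B" using t cyl_subset_B[OF w(3,1)] by auto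
    obtain a1 b1 where ab: "cyl w = {a1..b1}" using cyl_interval[OF w(3,1)] by blast
    have seg: "closed_segment t1 t2 \<subseteq> cyl w"
      unfolding ab by (rule closed_segment_subset) (use t ab in auto)
    have P: "\<exists>\<xi>\<in>cyl w. \<bar>P (n' + i) n t1 - P (n' + i) n t2\<bar> = \<bar>Gd (map s [m + i..<m + q]) \<xi>\<bar> * \<bar>t1 - t2\<bar>" for i
      unfolding P_def word using G_MVT[OF s_word s_in tJ] seg by (metis subsetD)
    have "(\<Sum>k\<in>{n'..<n}. \<bar>P k n t1 - P k n t2\<bar>) = (\<Sum>i<q. \<bar>P (n' + i) n t1 - P (n' + i) n t2\<bar>)"
      using sum.shift_bounds_nat_ivl[of "\<lambda>k. \<bar>P k n t1 - P k n t2\<bar>" 0 n' q] nk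
      by (simp add: add_ac atLeast0LessThan)
    also have "\<dots> \<le> (\<Sum>i<q. b i * \<bar>t1 - t2\<bar>)"
    proof (rule sum_mono)
      fix i
      obtain \<xi> where \<xi>: "\<xi> \<in> cyl w" "\<bar>P (n' + i) n t1 - P (n' + i) n t2\<bar> = \<bar>Gd (map s [m + i..<m + q]) \<xi>\<bar> * \<bar>t1 - t2\<bar>"
        using P by blast
      have "\<xi> \<in> B" using cyl_subset_B[OF w(3,1)] \<xi>(1) by blast
      then show "\<bar>P (n' + i) n t1 - P (n' + i) n t2\<bar> \<le> b i * \<bar>t1 - t2\<bar>"
        unfolding \<xi>(2) using b(2) by (intro mult_right_mono) auto
    qed
    finally show "(\<Sum>k\<in>{n'..<n}. \<bar>P k n t1 - P k n t2\<bar>) \<le> (\<Sum>i<q. b i) * \<bar>t1 - t2\<bar>"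
      by (simp add: sum_distrib_right)
    obtain \<xi> where \<xi>: "\<xi> \<in> cyl w" "\<bar>P n' n t1 - P n' n t2\<bar> = \<bar>Gd ?u \<xi>\<bar> * \<bar>t1 - t2\<bar>"
      using P[of 0] by auto
    show "\<bar>P n' n t1 - P n' n t2\<bar> \<le> \<rho> * \<bar>t1 - t2\<bar>"
      unfolding \<xi>(2) by (intro mult_right_mono small[OF \<xi>(1)]) simp
  qed
qed

text \<open>An inverse branch expanding at its fixed point could not shrink the cylinders around it.\<close>

lemma inverse_multiplier_le_1: "\<bar>Gd (map s [m..<m + q]) (y m)\<bar> \<le> 1"
proof (rule ccontr)
  let ?u = "map s [m..<m + q]"
  assume "\<not> \<bar>Gd ?u (y m)\<bar> \<le> 1"
  then have "\<bar>Gd ?u (y m)\<bar> - 1 > 0" by simp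
  then obtain \<eta> where \<eta>: "\<eta> > 0" "\<And>t. t \<in> B \<Longrightarrow> dist t (y m) < \<eta> \<Longrightarrow> dist (Gd ?u t) (Gd ?u (y m)) < \<bar>Gd ?u (y m)\<bar> - 1"
    using Gd_cont[OF s_word, of "[m..<m + q]"] y_B[of m] unfolding continuous_on_iff by blast
  \<comment> \<open>The pullbacks \<open>T k\<close> of a second point of \<open>J (s m)\<close>
    must tend to \<open>y m\<close> as their cylinders shrink. Within distance
    \<open>\<eta>\<close>, however, the branch does not decrease the distance to
    \<open>y m\<close>.\<close>
  define t0 where "t0 = lo (s m)"
  have t0: "t0 \<in> J (s m)" "t0 \<noteq> y m"
    using J_eq[OF s_in, of m] lo_less_hi[OF s_in, of m] y_interior[of m] by (auto simp: t0_def)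
  define T where "T k = P m (m + k * q) t0" for k
  have sk: "s (m + k * q) = s m" for k using s_periodic[of m k] by simp
  let ?w = "\<lambda>k. map s [m..<m + Suc (k * q)]"
  have wT: "T k \<in> cyl (?w k)" for k
    using cyl_P[of m "m + k * q"] t0 sk by (simp add: T_def)
  have wy: "y m \<in> cyl (?w k)" for k by (rule y_cyl) simp
  have TJ: "T k \<in> J (s m)" for k
  proof -
    have "cyl (map s [m..<m + 1]) = J (s m)" by (simp add: cyl_single)
    then show ?thesis using cyl_decreasing[of 1 "Suc (k * q)" m] wT[of k] by auto
  qed
  have fix_y: "G ?u (y m) = y m" 
    using y_P[of m "m + q"] y_periodic[of m 1] by (simp add: P_def)
  have step: "T (Suc k) = G ?u (T k)" for k
  proof -
    have "T (Suc k) = P m (m + q) (P (m + q) (m + Suc k * q) t0)"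
      unfolding T_def by (rule P_comp) auto
    also have "P (m + q) (m + Suc k * q) = P m (m + k * q)"
      unfolding P_def using map_s_periodic[of m 1 "m + k * q"] by (simp add: add_ac)
    finally show ?thesis by (simp add: T_def P_def)
  qed
  have ne: "T k \<noteq> y m" for k
  proof (induction k)
    case 0
    show ?case using t0 by (simp add: T_def)
  next
    case (Suc k)
    then show ?case
      using step[of k] fix_y G_inj[OF s_word, of "[m..<m + q]"] TJ[of k] y_B[of m] J_subset_B[OF s_in, of m]
      by (metis inj_onD subsetD)
  qed
  have grow: "\<bar>T (Suc k) - y m\<bar> \<ge> \<bar>T k - y m\<bar>" if "\<bar>T k - y m\<bar> < \<eta>" for k
  proof -
    obtain \<xi> where \<xi>: "\<xi> \<in> closed_segment (T k) (y m)" "\<bar>G ?u (T k) - G ?u (y m)\<bar> = \<bar>Gd ?u \<xi>\<bar> * \<bar>T k - y m\<bar>"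
      using G_MVT[OF s_word s_in TJ y_J] by blast
    have "\<bar>\<xi> - y m\<bar> < \<eta>" using \<xi>(1) that by (auto simp: closed_segment_eq_real_ivl split: if_splits)
    moreover have "\<xi> \<in> B" using \<xi>(1) segment_in_J[OF s_in TJ y_J] J_subset_B[OF s_in] by blast
    ultimately have "\<bar>Gd ?u \<xi>\<bar> \<ge> 1" using \<eta>(2)[of \<xi>] by (auto simp: dist_real_def)
    then have "1 * \<bar>T k - y m\<bar> \<le> \<bar>Gd ?u \<xi>\<bar> * \<bar>T k - y m\<bar>" by (intro mult_right_mono) auto
    then show ?thesis using step[of k] fix_y \<xi>(2) by simp
  qed
  have close: "\<exists>K. \<forall>k\<ge>K. \<bar>T k - y m\<bar> < \<epsilon>" if \<epsilon>: "\<epsilon> > 0" for \<epsilon>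
  proof -
    obtain N where N: "\<And>v t1 t2. set v \<subseteq> {1..p} \<Longrightarrow> length v \<ge> N \<Longrightarrow> t1 \<in> cyl v \<Longrightarrow> t2 \<in> cyl v \<Longrightarrow> \<bar>t1 - t2\<bar> < \<epsilon>"
      using cyl_small[OF \<epsilon>] by blast
    have "\<bar>T k - y m\<bar> < \<epsilon>" if "k \<ge> N" for k
    proof (rule N[OF s_word _ wT wy])
      have "k \<le> k * q" using q by simp
      moreover have "length (?w k) = Suc (k * q)" by simp
      ultimately show "N \<le> length (?w k)" using that by linarith
    qed
    then show ?thesis by blast
  qed
  obtain K where K: "\<And>k. k \<ge> K \<Longrightarrow> \<bar>T k - y m\<bar> < \<eta>" using close[OF \<eta>(1)] by blast
  have "\<bar>T (K + k) - y m\<bar> \<ge> \<bar>T K - y m\<bar>" for k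
  proof (induction k)
    case (Suc k)
    then show ?case using grow[OF K[of "K + k"]] by simp
  qed simp
  moreover have "\<bar>T K - y m\<bar> > 0" using ne[of K] by simp
  then obtain K' where "\<And>k. k \<ge> K' \<Longrightarrow> \<bar>T k - y m\<bar> < \<bar>T K - y m\<bar>" using close by blast
  then have "\<bar>T (K + K') - y m\<bar> < \<bar>T K - y m\<bar>" by simp
  ultimately show False by (meson not_le)
qed

end

section \<open>Domains of the iterates and exclusion of parabolic orbits from H\<close>

lemma iterate_defined_imp_cyl:
  assumes "\<And>j. j < Suc n \<Longrightarrow> (f ^^ j) z \<in> markov_dom p J g"
  shows "\<exists>w. set w \<subseteq> {1..p} \<and> length w = Suc (Suc n) \<and> z \<in> cyl w"
  using assms
proof (induction n arbitrary: z)
  case 0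
  \<comment> \<open>One application of \<open>f\<close> yields two letters: the branch and the
    interval containing the image. Hence the length exceeds the number of iterates by one.\<close>
  then obtain i t where it: "i \<in> {1..p}" "t \<in> B" "z = g i t" by (force simp: markov_dom_def)
  obtain j where j: "j \<in> {1..p}" "t \<in> J j" using B_cases[OF it(2)] by blast
  have "z \<in> cyl [i, j]" using cyl_Cons[of "[j]" i] it(3) j(2) by (simp add: cyl_single)
  then show ?case using it(1) j(1) by (intro exI[of _ "[i, j]"]) simp
next
  case (Suc n)
  have "z \<in> markov_dom p J g" using Suc.prems[of 0] by simp
  then obtain i t where it: "i \<in> {1..p}" "t \<in> B" "z = g i t" by (force simp: markov_dom_def)
  have fz: "f z = t" using markov_map_g it by simp
  have "(f ^^ j) (f z) \<in> markov_dom p J g" if "j < Suc n" for j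
    using Suc.prems[of "Suc j"] that by (simp add: funpow_swap1)
  then obtain w where w: "set w \<subseteq> {1..p}" "length w = Suc (Suc n)" "f z \<in> cyl w" using Suc.IH by blast
  have "w \<noteq> []" using w(2) by auto
  then have "z \<in> cyl (i # w)" using cyl_Cons[of w i] w(3) fz it(3) by simp
  then show ?case using w it(1) by (intro exI[of _ "i # w"]) simp
qed

text \<open>The iterate is defined only on finitely many pairwise disjoint closed cylinders of
  length \<open>n + 1\<close>. A connected ball stays in the one containing \<open>y 0\<close>, and
  being open it misses the ends.\<close>

lemma iterate_defined_ball:
  assumes n: "n > 0" and r: "r > 0" and dfd: "iterate_defined_on p J g n (ball (y 0) r)"
  shows "ball (y 0) r \<subseteq> P 0 n ` {lo (s n)<..<hi (s n)}"
proof -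
  let ?S = "ball (y 0) r" and ?w = "map s [0..<0 + Suc n]"
  let ?W = "{w. set w \<subseteq> {1..p} \<and> length w = Suc n} - {?w}"
  have cov: "?S \<subseteq> cyl ?w \<union> (\<Union>w\<in>?W. cyl w)"
  proof
    fix z assume z: "z \<in> ?S"
    have "(f ^^ j) z \<in> markov_dom p J g" if "j < Suc (n - 1)" for j
      using dfd z that n unfolding iterate_defined_on_def by simp
    then obtain w where "set w \<subseteq> {1..p}" "length w = Suc (Suc (n - 1))" "z \<in> cyl w"
      using iterate_defined_imp_cyl by blast
    then show "z \<in> cyl ?w \<union> (\<Union>w\<in>?W. cyl w)" using n by (cases "w = ?w") auto
  qed
  have closed: "closed (cyl w)" if w: "set w \<subseteq> {1..p}" "length w = Suc n" for w
  proof -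
    have "w \<noteq> []" using w by auto
    then obtain a b where "cyl w = {a..b}" using cyl_interval[OF w(1)] by blast
    then show ?thesis by simp
  qed
  have cw: "closed (cyl ?w)" by (rule closed[OF s_word]) simp
  have cW: "closed (\<Union>w\<in>?W. cyl w)"
    using finite_words[of "Suc n"] closed by (intro closed_UN) auto
  have disj: "cyl ?w \<inter> (\<Union>w\<in>?W. cyl w) = {}"
  proof (rule ccontr)
    assume "\<not> ?thesis"
    then obtain t w where tw: "t \<in> cyl ?w" "w \<in> ?W" "t \<in> cyl w" by blast
    then have "?w = take (length ?w) w"
      by (intro cyl_meet_prefix[OF s_word]) (auto simp del: upt_Suc)
    then show False using tw(2) by auto
  qed
  have y0: "y 0 \<in> cyl ?w \<inter> ?S" using y_cyl[of "Suc n" 0] r by simp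
  have "(\<Union>w\<in>?W. cyl w) \<inter> ?S = {}"
    using connected_closedD[OF connected_ball _ cov cw cW] disj y0 by blast
  then have "?S \<subseteq> cyl ?w" using cov by blast
  also have "cyl ?w = P 0 n ` J (s n)" using cyl_P[of 0 n] by simp
  finally have sub: "?S \<subseteq> P 0 n ` J (s n)" .
  have ends: "lo (s n) \<in> J (s n)" "hi (s n) \<in> J (s n)"
    using J_eq[OF s_in] lo_less_hi[OF s_in, of n] by auto
  have "J (s n) = closed_segment (lo (s n)) (hi (s n))"
    using J_eq[OF s_in] lo_less_hi[OF s_in, of n] by (simp add: closed_segment_eq_real_ivl)
  then have "P 0 n ` J (s n) = closed_segment (P 0 n (lo (s n))) (P 0 n (hi (s n)))"
    unfolding P_def using G_segment[OF s_word s_in ends] by simp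
  then have "?S \<subseteq> interior (closed_segment (P 0 n (lo (s n))) (P 0 n (hi (s n))))"
    using sub by (intro interior_maximal) auto
  then have int: "z \<noteq> P 0 n (lo (s n)) \<and> z \<noteq> P 0 n (hi (s n))" if "z \<in> ?S" for z
    using that by (auto simp: closed_segment_eq_real_ivl split: if_splits)
  show ?thesis
  proof
    fix z assume z: "z \<in> ?S"
    then obtain t where t: "t \<in> J (s n)" "z = P 0 n t" using sub by blast
    have "t \<noteq> lo (s n)" "t \<noteq> hi (s n)" using int[OF z] t(2) by auto
    then show "z \<in> P 0 n ` {lo (s n)<..<hi (s n)}" using t J_eq[OF s_in] by auto
  qed
qed

text \<open>Distortion bounds the derivative on the whole ball by \<open>c\<close> times its modulus
  at the center. The mean value theorem is applied to the inverse branch, whose derivative is the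
  reciprocal.\<close>

lemma diameter_iterate_ball_le:
  assumes n: "n > 0" and r: "r > 0" and dfd: "iterate_defined_on p J g n (ball (y 0) r)"
    and D: "Dist (f ^^ n) (ball (y 0) r) < ereal c"
  shows "diameter ((f ^^ n) ` ball (y 0) r) \<le> 2 * r * c / \<bar>Gd (map s [0..<n]) (y n)\<bar>"
proof -
  let ?S = "ball (y 0) r" and ?a = "\<bar>Gd (map s [0..<n]) (y n)\<bar>"
  have a: "?a > 0" by (rule Gd_y_pos)
  have y0: "y 0 \<in> ?S" using r by simp
  have pt: "\<exists>t\<in>{lo (s n)<..<hi (s n)}. z = P 0 n t" if "z \<in> ?S" for z
    using iterate_defined_ball[OF n r dfd] that by blast
  have sub_J: "{lo (s n)<..<hi (s n)} \<subseteq> J (s n)" using J_eq[OF s_in] by auto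
  have d0: "deriv (f ^^ n) (y 0) = inverse (Gd (map s [0..<n]) (y n))"
    using deriv_iterate_y[of n 0] by simp
  have bound: "\<bar>deriv (f ^^ n) z\<bar> \<le> c / ?a" if "z \<in> ?S" for z
  proof -
    have "ereal (\<bar>deriv (f ^^ n) z\<bar> / \<bar>deriv (f ^^ n) (y 0)\<bar>) \<le> Dist (f ^^ n) ?S"
      unfolding Dist_def using that y0 by (intro SUP_upper2[of "(z, y 0)"]) auto
    then have "ereal (\<bar>deriv (f ^^ n) z\<bar> / \<bar>deriv (f ^^ n) (y 0)\<bar>) < ereal c" using D by (rule le_less_trans)
    moreover have "\<bar>deriv (f ^^ n) (y 0)\<bar> = inverse ?a" by (simp add: d0 abs_inverse)
    ultimately have "\<bar>deriv (f ^^ n) z\<bar> * ?a \<le> c" by (simp add: divide_inverse)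
    then show ?thesis using a pos_le_divide_eq by blast
  qed
  have "c \<ge> 0" using bound[OF y0] a by (metis abs_ge_zero order_trans divide_less_0_iff not_le)
  show ?thesis
  proof (rule diameter_le)
    show "(f ^^ n) ` ?S \<noteq> {} \<or> 0 \<le> 2 * r * c / ?a" using y0 by blast
    fix v1 v2 assume "v1 \<in> (f ^^ n) ` ?S" "v2 \<in> (f ^^ n) ` ?S"
    then obtain z1 z2 where z: "z1 \<in> ?S" "v1 = (f ^^ n) z1" "z2 \<in> ?S" "v2 = (f ^^ n) z2" by (meson imageE)
    obtain t1 where t1: "t1 \<in> {lo (s n)<..<hi (s n)}" "z1 = P 0 n t1" using pt[OF z(1)] by blast
    obtain t2 where t2: "t2 \<in> {lo (s n)<..<hi (s n)}" "z2 = P 0 n t2" using pt[OF z(3)] by blast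
    have tJ: "t1 \<in> J (s n)" "t2 \<in> J (s n)" using t1 t2 sub_J by auto
    have v: "v1 = t1" "v2 = t2"
      using z t1 t2 iterate_P tJ J_subset_B[OF s_in] by (metis subsetD)+
    obtain \<xi> where \<xi>: "\<xi> \<in> closed_segment t1 t2" "\<bar>P 0 n t1 - P 0 n t2\<bar> = \<bar>Gd (map s [0..<n]) \<xi>\<bar> * \<bar>t1 - t2\<bar>"
      unfolding P_def using G_MVT[OF s_word s_in tJ] by blast
    have int: "lo (s n) < \<xi>" "\<xi> < hi (s n)"
      using \<xi>(1) t1(1) t2(1) by (auto simp: closed_segment_eq_real_ivl split: if_splits)
    have "P 0 n \<xi> \<in> closed_segment z1 z2"
      using \<xi>(1) G_segment[OF s_word s_in tJ, of "[0..<n]"] t1(2) t2(2) unfolding P_def by blast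
    also have "closed_segment z1 z2 \<subseteq> ?S" using z by (intro closed_segment_subset) auto
    finally have "\<bar>deriv (f ^^ n) (P 0 n \<xi>)\<bar> \<le> c / ?a" by (rule bound)
    then have inv: "\<bar>inverse (Gd (map s [0..<n]) \<xi>)\<bar> \<le> c / ?a"
      using DERIV_imp_deriv[OF iterate_deriv_P[OF int]] by simp
    have "\<xi> \<in> B" using int sub_J J_subset_B[OF s_in] by (meson greaterThanLessThan_iff subsetD)
    then have nz: "Gd (map s [0..<n]) \<xi> \<noteq> 0" by (rule Gd_nonzero[OF s_word])
    have "\<bar>t1 - t2\<bar> = \<bar>z1 - z2\<bar> * \<bar>inverse (Gd (map s [0..<n]) \<xi>)\<bar>"
      using \<xi>(2) t1(2) t2(2) nz by (simp add: field_simps)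
    also have "\<dots> \<le> (2 * r) * (c / ?a)"
    proof (rule mult_mono[OF _ inv])
      show "\<bar>z1 - z2\<bar> \<le> 2 * r" using z(1,3) by (auto simp: dist_real_def)
    qed (use r in auto)
    finally show "norm (v1 - v2) \<le> 2 * r * c / ?a" using v by simp
  qed
qed

text \<open>The derivatives of all iterates at \<open>y 0\<close> are at most \<open>1 / c\<close>
  in modulus. With bounded distortion the images of shrinking balls shrink as well, against the
  lower bound \<open>c1\<close>.\<close>

lemma not_in_H_set_if_bounded_derivative:
  assumes c: "c > 0" "\<And>n. \<bar>Gd (map s [0..<n]) (y n)\<bar> \<ge> c"
  shows "y 0 \<notin> H_set p J g Q"
proof
  assume "y 0 \<in> H_set p J g Q"
  then have "\<exists>c1>0. \<exists>c2>0. \<exists>(n :: nat \<Rightarrow> nat) (r :: nat \<Rightarrow> real).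
       strict_mono n \<and> (\<forall>k. r k > 0) \<and> decseq r \<and> r \<longlonglongrightarrow> 0 \<and>
       (\<forall>k. iterate_defined_on p J g (n k) (ball (y 0) (r k)) \<and>
            diameter ((f ^^ n k) ` ball (y 0) (r k)) > c1 \<and>
            Dist (f ^^ n k) (ball (y 0) (r k)) < ereal c2)"
    unfolding H_set_def by blast
  then obtain c1 c2 n r where h: "c1 > 0" "c2 > 0" "strict_mono n" "\<And>k. r k > (0::real)" "r \<longlonglongrightarrow> 0"
    "\<And>k. iterate_defined_on p J g (n k) (ball (y 0) (r k))"
    "\<And>k. diameter ((f ^^ n k) ` ball (y 0) (r k)) > c1"
    "\<And>k. Dist (f ^^ n k) (ball (y 0) (r k)) < ereal c2" by blast
  have "c1 * c / (2 * c2) > 0" using h c by simp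
  then have "\<forall>\<^sub>F k in sequentially. r k < c1 * c / (2 * c2)" by (rule order_tendstoD(2)[OF h(5)])
  then obtain k0 where k0: "\<And>k. k \<ge> k0 \<Longrightarrow> r k < c1 * c / (2 * c2)" by (auto simp: eventually_sequentially)
  \<comment> \<open>The successor makes the iterate \<open>n k\<close> positive.\<close>
  define k where "k = Suc k0"
  have nk: "n k > 0" using seq_suble[OF h(3), of k] by (simp add: k_def)
  have small: "2 * r k * c2 / c < c1"
    using k0[of k] h(2) c(1) by (simp add: k_def field_simps)
  have "c1 < diameter ((f ^^ n k) ` ball (y 0) (r k))" by (rule h(7))
  also have "\<dots> \<le> 2 * r k * c2 / \<bar>Gd (map s [0..<n k]) (y (n k))\<bar>"
    by (rule diameter_iterate_ball_le[OF nk h(4,6,8)])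
  also have "\<dots> \<le> 2 * r k * c2 / c"
    using c h(2) h(4)[of k] Gd_y_pos[of 0 "n k"] by (intro divide_left_mono mult_pos_pos) auto
  finally have "c1 < 2 * r k * c2 / c" .
  then show False using small by simp
qed

text \<open>\<open>a n\<close> is the reciprocal of the modulus of the derivative of the
  \<open>n\<close>-th iterate at \<open>y 0\<close>. A multiplier of modulus 1 makes it periodic
  from \<open>m\<close> on, so it takes finitely many values, all positive.\<close>

lemma not_in_H_set_if_parabolic:
  assumes q: "q > 0" "(f ^^ q) (y m) = y m" "\<bar>deriv (f ^^ q) (y m)\<bar> = 1"
  shows "y 0 \<notin> H_set p J g Q"
proof -
  define a where "a n = \<bar>Gd (map s [0..<n]) (y n)\<bar>" for n
  have yper: "y (n + q) = y n" if "n \<ge> m" for n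
  proof -
    have "y (m + q + k) = y (m + k)" for k
      using iterate_y[of k "m + q"] iterate_y[of k m] iterate_y[of q m] q(2) by simp
    from this[of "n - m"] show ?thesis using that by (simp add: add_ac)
  qed
  \<comment> \<open>Equal points lie in the same interval, so periodicity passes from the orbit to
    the coding.\<close>
  have sper: "s (n + q) = s n" if "n \<ge> m" for n
    using y_J[of "n + q"] y_J[of n] yper[OF that] J_disjoint s_in by metis
  have step: "a (Suc n) = a n * \<bar>gd (s n) (y (Suc n))\<bar>" for n
    using y_step[of n] by (simp add: a_def Gd_append abs_mult)
  have "a (m + q) = a m * \<bar>Gd (map s [m..<m + q]) (y (m + q))\<bar>"
    using map_upt_append[of 0 m "m + q"] y_P[of m "m + q"] by (simp add: a_def Gd_append abs_mult P_def)
  moreover have "\<bar>Gd (map s [m..<m + q]) (y (m + q))\<bar> = 1"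
    using q(3) deriv_iterate_y[of q m] by (simp add: abs_inverse)
  ultimately have base: "a (m + q) = a m" by simp
  have "a (m + k + q) = a (m + k)" for k
  proof (induction k)
    case (Suc k)
    have "a (m + Suc k + q) = a (m + k + q) * \<bar>gd (s (m + k + q)) (y (Suc (m + k) + q))\<bar>"
      using step[of "m + k + q"] by simp
    also have "\<dots> = a (m + k) * \<bar>gd (s (m + k)) (y (Suc (m + k)))\<bar>"
      using Suc sper[of "m + k"] yper[of "Suc (m + k)"] by simp
    also have "\<dots> = a (m + Suc k)" using step[of "m + k"] by simp
    finally show ?case .
  qed (use base in simp)
  then have aper: "a (n + q) = a n" if "n \<ge> m" for n using that by (metis le_add_diff_inverse)
  define c where "c = Min (a ` {..m + q})"
  have "a n > 0" for n unfolding a_def by (rule Gd_y_pos)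
  then have c: "c > 0" unfolding c_def by (subst Min_gr_iff) auto
  have "a n \<ge> c" for n
  proof (induction n rule: less_induct)
    case (less n)
    show ?case
    proof (cases "n \<le> m + q")
      case True
      then show ?thesis unfolding c_def by (intro Min_le) auto
    next
      case False
      then show ?thesis using less[of "n - q"] aper[of "n - q"] q(1) by simp
    qed
  qed
  then show ?thesis using not_in_H_set_if_bounded_derivative[OF c] by (simp add: a_def)
qed

text \<open>The multiplier of the inverse branch is squeezed: modulus below 1 would put
  \<open>y 0\<close> into H, and expansivity excludes modulus above 1.\<close>

lemma eventually_parabolic_if_not_in_H_set:
  assumes "y 0 \<notin> H_set p J g Q" and \<Lambda>: "\<And>n. y n \<in> Lambda_Q p J g Q"
  shows "parabolic_preperiodic p J g Q (y 0)"
proof -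
  obtain q where q: "q > 0" "finite {n. s (n + q) \<noteq> s n}"
    using in_H_set_if_aperiodic[of Q] assms by blast
  obtain n0 where n0: "\<forall>n\<in>{n. s (n + q) \<noteq> s n}. n < n0"
    using q(2) unfolding finite_nat_set_iff_bounded by blast
  \<comment> \<open>The successor provides \<open>m \<ge> 1\<close>, as preperiodicity requires;
    points that are themselves periodic are covered too.\<close>
  define m where "m = Suc n0"
  have per: "s (n + q) = s n" if "n \<ge> m" for n using n0 that unfolding m_def by fastforce
  have "\<not> \<bar>Gd (map s [m..<m + q]) (y m)\<bar> < 1"
    using in_H_set_if_hyperbolic[OF q(1) per, where m = m] assms by blast
  then have "\<bar>Gd (map s [m..<m + q]) (y m)\<bar> = 1"
    using inverse_multiplier_le_1[OF q(1) per, where m = m] by simp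
  moreover have yq: "y (m + q) = y m" using y_periodic[OF q(1) per, where k = 1 and n = m] by simp
  ultimately have "\<bar>deriv (f ^^ q) (y m)\<bar> = 1" using deriv_iterate_y[of q m] by (simp add: abs_inverse)
  moreover have "(f ^^ q) (y m) = y m" using iterate_y[of q m] yq by simp
  ultimately have "parabolic_periodic p J g Q (y m)"
    unfolding parabolic_periodic_def using \<Lambda>[of m] q(1) by (metis One_nat_def Suc_leI)
  moreover have "(f ^^ m) (y 0) = y m" using iterate_y[of m 0] by simp
  ultimately show ?thesis
    unfolding parabolic_preperiodic_def using \<Lambda>[of 0] by (metis m_def One_nat_def Suc_leI zero_less_Suc)
qed

end

section \<open>The characterization of the complement of H\<close>

theorem theorem2:
  fixes I :: "real set" and p :: nat and J :: "nat \<Rightarrow> real set"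
    and g :: "nat \<Rightarrow> real \<Rightarrow> real" and Q :: "nat list set" and x :: real
  assumes "markov_system I p J g"
    and "expansive p J g"
    and "finite Q" and "\<forall>w\<in>Q. set w \<subseteq> {1..p}"
    and "Sigma_Q p Q \<noteq> {}" and "shift ` Sigma_Q p Q = Sigma_Q p Q"
    and "transitive_system p J g Q"
    and "x \<in> Lambda_Q p J g Q"
  shows "x \<in> Lambda_Q p J g Q - H_set p J g Q \<longleftrightarrow>
         parabolic_periodic p J g Q x \<or> parabolic_preperiodic p J g Q x"
proof -
  obtain s where s: "s \<in> Sigma_Q p Q" "x = coding J g s"
    using assms(8) by (auto simp: Lambda_Q_def)
  interpret markov_orbit I p J g s
    using assms(1,2) s(1) by unfold_locales (auto simp: Sigma_Q_def)
  have x: "x = y 0" by (simp add: y_def s(2))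
  \<comment> \<open>Tails of an admissible sequence are admissible, so the whole orbit stays in
    \<open>Lambda_Q\<close>.\<close>
  have tail: "(\<lambda>k. s (n + k)) \<in> Sigma_Q p Q" for n
  proof -
    have "map (\<lambda>k. s (n + k)) [k..<k + l] = map s [n + k..<n + k + l]" for k l
      by (rule nth_equalityI) (auto simp: add.assoc)
    moreover have "\<And>w k. w \<in> Q \<Longrightarrow> map s [k..<k + length w] \<noteq> w"
      using s(1) unfolding Sigma_Q_def by blast
    ultimately show ?thesis using s_in unfolding Sigma_Q_def by auto
  qed
  have \<Lambda>: "y n \<in> Lambda_Q p J g Q" for n
    unfolding y_def Lambda_Q_def by (rule imageI[OF tail])
  have not_H: "y 0 \<notin> H_set p J g Q" if "parabolic_periodic p J g Q (y m)" for m
    using that not_in_H_set_if_parabolic unfolding parabolic_periodic_def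
    by (metis One_nat_def Suc_le_lessD)
  show ?thesis
  proof
    assume "x \<in> Lambda_Q p J g Q - H_set p J g Q"
    then show "parabolic_periodic p J g Q x \<or> parabolic_preperiodic p J g Q x"
      using eventually_parabolic_if_not_in_H_set \<Lambda> x by blast
  next
    assume "parabolic_periodic p J g Q x \<or> parabolic_preperiodic p J g Q x"
    \<comment> \<open>The case \<open>m = 0\<close> covers periodic points.\<close>
    then obtain m where "parabolic_periodic p J g Q (y m)"
      using x iterate_y[of _ 0] unfolding parabolic_preperiodic_def by auto
    then show "x \<in> Lambda_Q p J g Q - H_set p J g Q" using not_H \<Lambda> x by blast
  qed
qed

end
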